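(* Let $n,k$ be integers with $3\le k\le n-1$. Let $r,m$ be positive integers such that $q=\frac rm$ satisfies $\frac1k<q<\frac{n-k+1}{2n-k}$, and define for $x\in\mathbb{R}^n$ \[L_k(x)=\frac{x_1+\dots+x_{n-k+1}}{n-k+1},\qquad L(x)=\frac{1}{1-q}\left(\frac{x_1+\dots+x_n}{n}-qL_k(x)\right),\qquad p(x)=L_k(x)^rL(x)^{m-r}.\] Define a polynomial $F$ on the space $\mathcal{S}(n)$ of real symmetric $n\times n$ matrices by $F(X)=p(X_{11},\dots,X_{nn})$ for $X=(X_{ij})\in\mathcal{S}(n)$. Then $F$ is an $I_n$-central hyperbolic polynomial of degree $m$ on $\mathcal{S}(n)$ whose Gårding cone satisfies $\Gamma(F)_+\supset\Gamma_{\mathcal{S}}(n,k)_+$, but $\sigma_k$ majorization fails for $F$: for all sufficiently small $\varepsilon>0$, the positive definite diagonal matrix $X_\varepsilon=\operatorname{diag}(\varepsilon,\dots,\varepsilon,1,\dots,1)$ (with $n-k+1$ entries $\varepsilon$ followed by $k-1$ entries $1$) satisfies \[F(X_\varepsilon)^{\frac1m}<F(I_n)^{\frac1m}\left(\frac{\sigma_k(X_\varepsilon)}{\binom nk}\right)^{\frac1k}.\]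
   Context: $I_n$ is the identity matrix. For $X\in\mathcal{S}(n)$ with eigenvalues $\lambda_1(X),\dots,\lambda_n(X)$, $\sigma_k(X)=\sum_{i_1<\dots<i_k}\lambda_{i_1}(X)\cdots\lambda_{i_k}(X)$. A homogeneous polynomial $p$ of degree $m$ (with $m \ge 1$) on a finite-dimensional real vector space $V$ is hyperbolic with respect to $a\in V$ ($a$-hyperbolic) if $p(a)>0$ and for every $x\in V$ the polynomial $s\mapsto p(sa+x)$ has only real roots; then $p(sa+x)=p(a)\prod_{j=1}^m(s+\lambda_j^{p,a}(x))$ with real $\lambda_j^{p,a}(x)$. Its Gårding cone is $\Gamma(p)_+=\{x:\lambda^{p,a}_j(x)>0\ \forall j\}$, equivalently the connected component of $\{p>0\}$ containing $a$. Set $\operatorname{tr}^{p,a}(x)=\sum_{j=1}^m\lambda_j^{p,a}(x)$. An $I_n$-hyperbolic polynomial $F$ of degree $m$ on $\mathcal{S}(n)$ is $I_n$-central if there is a constant $\kappa>0$ with $\operatorname{tr}^{F,I_n}(X)=\kappa\operatorname{tr}(X)$ for all $X\in\mathcal{S}(n)$ (necessarily $\kappa=m/n$). Gårding cones on $\mathcal{S}(n)$ here are taken with respect to $I_n$. The polynomial $\sigma_k$ on $\mathcal{S}(n)$ is $I_n$-hyperbolic, and $\Gamma_{\mathcal{S}}(n,k)_+$ denotes its Gårding cone with respect to $I_n$; a matrix $X$ lies in it if and only if its eigenvalue vector lies in the connected component containing $(1,\dots,1)$ of the set where the $k$-th elementary symmetric function on $\mathbb{R}^n$ is positive. *)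

theory Defs
  imports "Jordan_Normal_Form.Char_Poly" "Jordan_Normal_Form.VS_Connect"
begin

text \<open>
  A real vector space \<open>V\<close> is a \<open>module\<close> record with scalars in \<open>real\<close>. A polynomial on \<open>V\<close> is
  a function on the type of the vectors; only its values on \<open>carrier V\<close> matter.
\<close>

definition linear_form :: "(real, 'v) module \<Rightarrow> ('v \<Rightarrow> real) \<Rightarrow> bool" where
  "linear_form V l \<longleftrightarrow>
     (\<forall>x\<in>carrier V. \<forall>y\<in>carrier V. l (x \<oplus>\<^bsub>V\<^esub> y) = l x + l y) \<and>
     (\<forall>c. \<forall>x\<in>carrier V. l (c \<odot>\<^bsub>V\<^esub> x) = c * l x)"

text \<open>
  The homogeneous polynomials of degree \<open>m\<close> on \<open>V\<close> are the elements of the \<open>m\<close>-th symmetric power of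
  the dual space: linear combinations of products of \<open>m\<close> linear forms. In particular \<open>0\<close> is
  homogeneous of every degree; a nonzero one determines \<open>m\<close>.
\<close>

definition homogeneous_polynomial :: "(real, 'v) module \<Rightarrow> nat \<Rightarrow> ('v \<Rightarrow> real) \<Rightarrow> bool" where
  "homogeneous_polynomial V m p \<longleftrightarrow>
     (\<exists>(N::nat) (c :: nat \<Rightarrow> real) (l :: nat \<Rightarrow> nat \<Rightarrow> 'v \<Rightarrow> real).
        (\<forall>i<N. \<forall>j<m. linear_form V (l i j)) \<and>
        (\<forall>x\<in>carrier V. p x = (\<Sum>i<N. c i * (\<Prod>j<m. l i j x))))"

text \<open>
  "Only real roots" refers to the complex roots of the univariate polynomial \<open>P\<close> given by
  \<open>s \<mapsto> p (s a + x)\<close>.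
\<close>

definition hyperbolic_polynomial ::
    "(real, 'v) module \<Rightarrow> nat \<Rightarrow> ('v \<Rightarrow> real) \<Rightarrow> 'v \<Rightarrow> bool" where
  "hyperbolic_polynomial V m p a \<longleftrightarrow>
     1 \<le> m \<and> homogeneous_polynomial V m p \<and> a \<in> carrier V \<and> p a > 0 \<and>
     (\<forall>x\<in>carrier V. \<exists>P :: real poly.
        (\<forall>s. poly P s = p (s \<odot>\<^bsub>V\<^esub> a \<oplus>\<^bsub>V\<^esub> x)) \<and>
        (\<forall>z::complex. poly (map_poly of_real P) z = 0 \<longrightarrow> z \<in> \<real>))"

text \<open>
  The multiset of the numbers \<open>\<lambda>\<^sub>j\<close>; it exists and is unique whenever \<open>p\<close> is hyperbolic with
  respect to \<open>a\<close>, and its size is then the degree of \<open>p\<close>.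
\<close>

definition hyp_eigenvalues ::
    "(real, 'v) module \<Rightarrow> ('v \<Rightarrow> real) \<Rightarrow> 'v \<Rightarrow> 'v \<Rightarrow> real multiset" where
  "hyp_eigenvalues V p a x =
     (THE M. \<forall>s. p (s \<odot>\<^bsub>V\<^esub> a \<oplus>\<^bsub>V\<^esub> x) = p a * (\<Prod>t\<in>#M. s + t))"

definition garding_cone :: "(real, 'v) module \<Rightarrow> ('v \<Rightarrow> real) \<Rightarrow> 'v \<Rightarrow> 'v set" where
  "garding_cone V p a = {x \<in> carrier V. \<forall>t\<in>#hyp_eigenvalues V p a x. t > 0}"

definition hyp_trace :: "(real, 'v) module \<Rightarrow> ('v \<Rightarrow> real) \<Rightarrow> 'v \<Rightarrow> 'v \<Rightarrow> real" where
  "hyp_trace V p a x = (\<Sum>t\<in>#hyp_eigenvalues V p a x. t)"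

definition sym_mats :: "nat \<Rightarrow> (real, real mat) module" where
  "sym_mats n = (module_mat TYPE(real) n n)
     \<lparr>carrier := {A \<in> carrier_mat n n. transpose_mat A = A}\<rparr>"

lemma vectorspace_sym_mats: "vectorspace (class_ring :: real ring) (sym_mats n)"
  unfolding vectorspace_def
proof
  have smult: "transpose_mat (c \<cdot>\<^sub>m v) = c \<cdot>\<^sub>m transpose_mat v" for c :: real and v
    by (rule eq_matI) auto
  show "module (class_ring :: real ring) (sym_mats n)"
  proof (rule module_criteria)
    show "cring (class_ring :: real ring)"
      by (rule class_cring.is_cring)
    show "\<forall>v\<in>carrier (sym_mats n). \<exists>w\<in>carrier (sym_mats n). v \<oplus>\<^bsub>sym_mats n\<^esub> w = \<zero>\<^bsub>sym_mats n\<^esub>"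
    proof
      fix v assume v: "v \<in> carrier (sym_mats n)"
      then have "- v \<in> carrier (sym_mats n)" "v + - v = 0\<^sub>m n n"
        by (auto simp: sym_mats_def module_mat_def transpose_uminus)
      then show "\<exists>w\<in>carrier (sym_mats n). v \<oplus>\<^bsub>sym_mats n\<^esub> w = \<zero>\<^bsub>sym_mats n\<^esub>"
        by (intro bexI[of _ "- v"]) (auto simp: sym_mats_def module_mat_def)
    qed
  qed (auto simp: sym_mats_def module_mat_def transpose_add smult add_smult_distrib_left_mat
      add_smult_distrib_right_mat intro!: eq_matI simp: algebra_simps)
qed (rule class_field)

definition mat_trace :: "real mat \<Rightarrow> real" where
  "mat_trace A = sum_list (diag_mat A)"

definition pos_def_mat :: "nat \<Rightarrow> real mat \<Rightarrow> bool" where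
  "pos_def_mat n A \<longleftrightarrow> A \<in> carrier (sym_mats n) \<and>
     (\<forall>v\<in>carrier_vec n. v \<noteq> 0\<^sub>v n \<longrightarrow> v \<bullet> (A *\<^sub>v v) > 0)"

definition central_hyperbolic :: "nat \<Rightarrow> nat \<Rightarrow> (real mat \<Rightarrow> real) \<Rightarrow> bool" where
  "central_hyperbolic n m F \<longleftrightarrow>
     hyperbolic_polynomial (sym_mats n) m F (1\<^sub>m n) \<and>
     (\<exists>\<kappa>>0. \<forall>X\<in>carrier (sym_mats n). hyp_trace (sym_mats n) F (1\<^sub>m n) X = \<kappa> * mat_trace X)"

definition elem_sym :: "nat \<Rightarrow> real list \<Rightarrow> real" where
  "elem_sym k xs = (\<Sum>I | I \<subseteq> {..<length xs} \<and> card I = k. \<Prod>i\<in>I. xs ! i)"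

text \<open>
  The eigenvalues in increasing order, repeated according to multiplicity. For a real symmetric
  matrix of size \<open>n\<close> the characteristic polynomial splits over the reals, so there are \<open>n\<close> of them.
\<close>

definition eigenvalue_list :: "real mat \<Rightarrow> real list" where
  "eigenvalue_list A = sorted_list_of_multiset (proots (char_poly A))"

definition sigma :: "nat \<Rightarrow> real mat \<Rightarrow> real" where
  "sigma k X = elem_sym k (eigenvalue_list X)"

text \<open>Coordinates are numbered from \<open>0\<close>, so \<open>x\<^sub>1, \<dots>, x\<^sub>n\<close> are \<open>x $ 0, \<dots>, x $ (n - 1)\<close>.\<close>

definition Lk_form :: "nat \<Rightarrow> nat \<Rightarrow> real vec \<Rightarrow> real" where
  "Lk_form n k x = (\<Sum>i<n - k + 1. x $ i) / real (n - k + 1)"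

definition L_form :: "nat \<Rightarrow> nat \<Rightarrow> real \<Rightarrow> real vec \<Rightarrow> real" where
  "L_form n k q x = 1 / (1 - q) * ((\<Sum>i<n. x $ i) / real n - q * Lk_form n k x)"

definition p_poly :: "nat \<Rightarrow> nat \<Rightarrow> nat \<Rightarrow> nat \<Rightarrow> real vec \<Rightarrow> real" where
  "p_poly n k r m x = Lk_form n k x ^ r * L_form n k (real r / real m) x ^ (m - r)"

definition F_poly :: "nat \<Rightarrow> nat \<Rightarrow> nat \<Rightarrow> nat \<Rightarrow> real mat \<Rightarrow> real" where
  "F_poly n k r m X = p_poly n k r m (vec n (\<lambda>i. X $$ (i, i)))"

definition X_eps :: "nat \<Rightarrow> nat \<Rightarrow> real \<Rightarrow> real mat" where
  "X_eps n k \<epsilon> = mat_diag n (\<lambda>i. if i < n - k + 1 then \<epsilon> else 1)"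

end

theory Submission
  imports Defs "Jordan_Normal_Form.Schur_Decomposition"
begin

text \<open>
  Diagonalise a symmetric \<open>X\<close> by an orthogonal matrix \<open>P\<close>, with eigenvalues \<open>\<lambda>\<close>. As a function of
  \<open>s\<close>, \<open>\<sigma>\<^sub>k(s I + X)\<close> is a multiple of the \<open>(n - k)\<close>-th derivative of \<open>\<Prod>(s + \<lambda>\<^sub>j)\<close>, so it splits over
  the reals, and if \<open>X\<close> lies in the cone of \<open>\<sigma>\<^sub>k\<close> then \<open>\<sigma>\<^sub>1(\<lambda>), \<dots>, \<sigma>\<^sub>k(\<lambda>) > 0\<close>. By Newton's inequalities this
  positivity survives, with \<open>k - 1\<close> for \<open>k\<close>, when one eigenvalue is removed. Hence any \<open>n - k + 1\<close>
  eigenvalues have positive sum, and Maclaurin's inequality for the remaining eigenvalues gives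
  \<open>n (k - 1) \<lambda>\<^sub>j \<ge> - (n - k) tr X\<close>. The diagonal entries of \<open>X\<close> are averages of the eigenvalues with the
  doubly stochastic weights \<open>P\<^sub>i\<^sub>j\<^sup>2\<close>, so the same two bounds hold for them. The first says
  \<open>L\<^sub>k > 0\<close>; the second, summed over the last \<open>k - 1\<close> entries, gives \<open>L > 0\<close> by the upper bound on \<open>q\<close>.
  Majorization fails because \<open>F(X\<^sub>\<epsilon>)\<close> to the power \<open>1/m\<close> is of order \<open>\<epsilon>\<close> to the power \<open>q\<close>, whereas
  \<open>\<sigma>\<^sub>k(X\<^sub>\<epsilon>) \<ge> \<epsilon>\<close> and \<open>q > 1/k\<close>.
\<close>

section \<open>Real-rooted polynomials and elementary symmetric functions\<close>

text \<open>The elements are the negatives of the roots, which matches the convention p(sa + x) =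
  p(a) prod (s + \<lambda>_j).\<close>

definition linprod :: "real multiset \<Rightarrow> real poly" where
  "linprod M = (\<Prod>x\<in>#M. [:x, 1:])"

text \<open>Encoded through the generating function prod (1 + x t), so that adding an element is
  multiplication by one linear factor and all recursions are read off from coefficients.\<close>

definition esym :: "real multiset \<Rightarrow> nat \<Rightarrow> real" where
  "esym M k = coeff (\<Prod>x\<in>#M. [:1, x:]) k"

lemma linprod_empty [simp]: "linprod {#} = 1"
  and linprod_add_mset [simp]: "linprod (add_mset x M) = [:x, 1:] * linprod M"
  by (simp_all add: linprod_def)

lemma esym_empty: "esym {#} k = (if k = 0 then 1 else 0)"
  by (simp add: esym_def coeff_1)

lemma esym_0 [simp]: "esym M 0 = 1"
  by (induction M) (simp_all add: esym_def coeff_mult)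

lemma esym_add_mset_Suc: "esym (add_mset x M) (Suc k) = esym M (Suc k) + x * esym M k"
  by (simp add: esym_def mult_pCons_left)

lemma esym_eq_0: "size M < k \<Longrightarrow> esym M k = 0"
proof (induction M arbitrary: k)
  case (add x M)
  then show ?case by (cases k) (simp_all add: esym_add_mset_Suc)
qed (simp add: esym_empty)

lemma esym_1: "esym M (Suc 0) = sum_mset M"
  by (induction M) (simp_all add: esym_empty esym_add_mset_Suc)

lemma lead_coeff_linprod: "lead_coeff (linprod M) = 1"
  by (induction M) (simp_all add: lead_coeff_mult del: mult_pCons_left)

lemma linprod_nonzero [simp]: "linprod M \<noteq> 0"
  using lead_coeff_linprod[of M] by auto

lemma degree_linprod [simp]: "degree (linprod M) = size M"
  by (induction M) (simp_all add: degree_mult_eq del: mult_pCons_left)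

lemma coeff_linprod: "k \<le> size M \<Longrightarrow> coeff (linprod M) (size M - k) = esym M k"
proof (induction M arbitrary: k)
  case (add x M)
  show ?case
  proof (cases k)
    case 0
    then show ?thesis
      using lead_coeff_linprod[of "add_mset x M"] by (simp only: degree_linprod) simp
  next
    case (Suc j)
    then have j: "j \<le> size M" using add.prems by simp
    show ?thesis
    \<comment> \<open>If \<open>j = size M\<close>, the coefficient in question is the constant one,
      to which only the constant term \<open>x\<close> of the new factor contributes; otherwise both
      terms of the factor do.\<close>
    proof (cases "j = size M")
      case True
      then show ?thesis
        using add.IH[of j] Suc by (simp add: esym_add_mset_Suc esym_eq_0)
    next
      case False
      then have "size M - j = Suc (size M - Suc j)" using j by simp
      then show ?thesis
        using add.IH[of j] add.IH[of "Suc j"] Suc j False by (simp add: esym_add_mset_Suc)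
    qed
  qed
qed (simp add: esym_empty)

lemma map_poly_complex_of_real_mult:
  "map_poly complex_of_real (p * q) = map_poly of_real p * map_poly of_real q"
  by (rule poly_eqI) (simp add: coeff_map_poly coeff_mult)

text \<open>Induction on the degree: the fundamental theorem of algebra supplies a complex root,
  which is real by hypothesis, and its linear factor is split off over the reals.\<close>

lemma real_rooted_eq_linprod:
  fixes p :: "real poly"
  assumes "p \<noteq> 0" and "\<And>z::complex. poly (map_poly of_real p) z = 0 \<Longrightarrow> z \<in> \<real>"
  shows "\<exists>M. p = Polynomial.smult (lead_coeff p) (linprod M)"
  using assms
proof (induction "degree p" arbitrary: p)
  case 0
  then obtain c where "p = [:c:]" by (metis degree_eq_zeroE)
  then show ?case by (intro exI[of _ "{#}"]) simp
next
  case (Suc d)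
  have "degree (map_poly complex_of_real p) = Suc d"
    using Suc.hyps by (simp add: degree_map_poly)
  then have "\<not> constant (poly (map_poly complex_of_real p))"
    using constant_degree by (metis Zero_not_Suc)
  then obtain z where z: "poly (map_poly complex_of_real p) z = 0"
    using fundamental_theorem_of_algebra by blast
  then obtain r where r: "z = of_real r"
    using Suc.prems by (blast elim: Reals_cases)
  have "poly p r = 0"
    using z unfolding r by simp
  then obtain q where q: "p = [:- r, 1:] * q"
    by (auto simp: poly_eq_0_iff_dvd dvd_def)
  have "q \<noteq> 0" using q Suc.prems by auto
  have deg: "d = degree q"
    using Suc.hyps \<open>q \<noteq> 0\<close> unfolding q by (subst (asm) degree_mult_eq) auto
  have "map_poly complex_of_real p = map_poly of_real [:- r, 1:] * map_poly of_real q"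
    unfolding q by (rule map_poly_complex_of_real_mult)
  then have "\<exists>M. q = Polynomial.smult (lead_coeff q) (linprod M)"
    by (intro Suc.hyps(1) deg \<open>q \<noteq> 0\<close> Suc.prems(2)) simp
  then obtain M where "q = Polynomial.smult (lead_coeff q) (linprod M)" by blast
  moreover have "lead_coeff p = lead_coeff q"
    unfolding q by (simp only: lead_coeff_mult) simp
  ultimately have "p = Polynomial.smult (lead_coeff p) (linprod (add_mset (- r) M))"
    by (metis linprod_add_mset mult_smult_right q)
  then show ?case by blast
qed

lemma poly_linprod: "poly (linprod M) s = (\<Prod>t\<in>#M. s + t)"
  by (induction M) (simp_all add: algebra_simps)

lemma map_poly_linprod_add_mset:
  "map_poly complex_of_real (linprod (add_mset x M))
    = [:of_real x, 1:] * map_poly of_real (linprod M)"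
  by (simp only: linprod_add_mset map_poly_complex_of_real_mult) simp

lemma linprod_complex_root_real:
  assumes "poly (map_poly complex_of_real (linprod M)) z = 0"
  shows "z \<in> \<real>"
  using assms
proof (induction M)
  case (add x M)
  then have "of_real x + z = 0 \<or> poly (map_poly complex_of_real (linprod M)) z = 0"
    by (simp add: map_poly_linprod_add_mset del: linprod_add_mset mult_pCons_left)
  then show ?case
    using add.IH by (auto simp: complex_is_Real_iff complex_eq_iff)
qed simp

lemma proots_linprod: "proots (linprod M) = image_mset uminus M"
  by (induction M) (simp_all add: proots_mult del: mult_pCons_left)

text \<open>The root multiset determines the elements up to sign. This is what makes hyperbolic
  eigenvalues unique.\<close>

lemma linprod_inject: "linprod M = linprod N \<Longrightarrow> M = N"
proof -
  assume "linprod M = linprod N"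
  then have "image_mset uminus (image_mset uminus M) = image_mset uminus (image_mset uminus N)"
    by (metis proots_linprod)
  then show "M = N" by (simp add: multiset.map_comp comp_def)
qed

text \<open>Gauss-Lucas for real roots: P'/P is the sum of the 1/(z + x), and each term has
  imaginary part -Im z / |z + x|^2. Off the real axis all these have the same sign, so P' has no
  zero there and splits by \<open>real_rooted_eq_linprod\<close>.\<close>

lemma pderiv_linprod:
  assumes "M \<noteq> {#}"
  shows "\<exists>T. Suc (size T) = size M \<and> pderiv (linprod M) = Polynomial.smult (real (size M)) (linprod T)"
proof -
  let ?P = "\<lambda>M. map_poly complex_of_real (linprod M)"
  have P_nz: "poly (?P M) z \<noteq> 0" if "Im z \<noteq> 0" for z M
    using linprod_complex_root_real[of M z] that by (auto simp: complex_is_Real_iff)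
  have log_deriv: "poly (pderiv (?P M)) z = poly (?P M) z * (\<Sum>x\<in>#M. 1 / (z + of_real x))"
    if "Im z \<noteq> 0" for z M
  proof (induction M)
    case (add x M)
    have "z + of_real x \<noteq> 0" using that by (auto simp: complex_eq_iff)
    moreover have "poly (pderiv (?P (add_mset x M))) z
        = poly (?P M) z + (z + of_real x) * poly (pderiv (?P M)) z"
      by (simp add: map_poly_linprod_add_mset pderiv_mult pderiv_pCons add.commute del: linprod_add_mset mult_pCons_left)
    moreover have "poly (?P (add_mset x M)) z = (z + of_real x) * poly (?P M) z"
      by (simp add: map_poly_linprod_add_mset add.commute del: linprod_add_mset mult_pCons_left)
    moreover define S where "S = (\<Sum>y\<in>#M. 1 / (z + complex_of_real y))"
    then have "poly (pderiv (?P M)) z = poly (?P M) z * S"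
      "(\<Sum>y\<in>#add_mset x M. 1 / (z + complex_of_real y)) = 1 / (z + complex_of_real x) + S"
      using add.IH by simp_all
    ultimately show ?case
      by (simp only:) (simp add: field_simps)
  qed simp
  have Im_neg: "Im z * Im (\<Sum>x\<in>#M. 1 / (z + of_real x)) < 0" if "Im z \<noteq> 0" "M \<noteq> {#}" for z M
    using that(2)
  proof (induction M)
    case (add x M)
    have "z + of_real x \<noteq> 0" using that by (auto simp: complex_eq_iff)
    then have "cmod (z + of_real x) > 0" by simp
    then have "Im z * Im (1 / (z + of_real x)) < 0"
      using that by (simp add: Im_divide cmod_def divide_simps) 
         (auto simp: power2_eq_square zero_less_mult_iff sum_power2_gt_zero_iff add_pos_nonneg)
    then show ?case using add.IH by (cases "M = {#}") (simp_all add: distrib_left)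
  qed simp
  let ?p = "pderiv (linprod M)"
  have "size M \<noteq> 0" using assms by simp
  have lc: "lead_coeff ?p = real (size M)"
    using lead_coeff_linprod[of M] \<open>size M \<noteq> 0\<close>
    by (cases "size M") (simp_all add: degree_pderiv coeff_pderiv)
  then have "?p \<noteq> 0" using \<open>size M \<noteq> 0\<close> by auto
  moreover have "z \<in> \<real>" if "poly (map_poly of_real ?p) z = 0" for z :: complex
  proof (rule ccontr)
    assume "z \<notin> \<real>"
    then have "Im z \<noteq> 0" by (simp add: complex_is_Real_iff)
    moreover have "map_poly complex_of_real ?p = pderiv (?P M)"
      by (rule poly_eqI) (simp add: coeff_map_poly coeff_pderiv)
    ultimately have "poly (?P M) z * (\<Sum>x\<in>#M. 1 / (z + of_real x)) = 0"
      using that log_deriv[of z M] by metis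
    then have "(\<Sum>x\<in>#M. 1 / (z + of_real x)) = 0"
      using P_nz[OF \<open>Im z \<noteq> 0\<close>] by (meson mult_eq_0_iff)
    then show False
      using Im_neg[OF \<open>Im z \<noteq> 0\<close> assms] by (metis less_irrefl mult_zero_right zero_complex.sel(2))
  qed
  ultimately obtain T where T: "?p = Polynomial.smult (lead_coeff ?p) (linprod T)"
    using real_rooted_eq_linprod by blast
  have "degree ?p = size T"
    using \<open>?p \<noteq> 0\<close> by (subst T) simp
  then have "Suc (size T) = size M"
    using \<open>size M \<noteq> 0\<close> unfolding degree_pderiv degree_linprod by linarith
  then show ?thesis
    using T lc by auto
qed

section \<open>Newton's inequalities\<close>

text \<open>With this normalisation, differentiating \<open>linprod M\<close> leaves the values
  unchanged, and Newton's inequalities carry no constants.\<close>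

definition mean_esym :: "real multiset \<Rightarrow> nat \<Rightarrow> real" where
  "mean_esym M k = esym M k / real (size M choose k)"

lemma frac_eq_cross:
  fixes n :: real
  assumes "n * e = d * f" "d * c = n * b" "b > 0" "c > 0" "n > 0"
  shows "e / b = f / c"
proof -
  have "n * (e * c) = n * (f * b)"
    using assms(1,2) by (metis mult.assoc mult.commute)
  then show ?thesis using assms by (simp add: field_simps)
qed

text \<open>Comparing coefficients in P' gives n e_k(T) = (n - k) e_k(M) for n =
  \<open>size M\<close>, and the binomial coefficients of n - 1 and n over k have the same
  ratio.\<close>

lemma mean_esym_pderiv:
  assumes "M \<noteq> {#}"
  shows "\<exists>T. Suc (size T) = size M \<and> (\<forall>k\<le>size T. mean_esym T k = mean_esym M k)"
proof -
  obtain T where T: "Suc (size T) = size M"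
      "pderiv (linprod M) = Polynomial.smult (real (size M)) (linprod T)"
    using pderiv_linprod[OF assms] by blast
  have "mean_esym T k = mean_esym M k" if k: "k \<le> size T" for k
  proof -
    have "coeff (pderiv (linprod M)) (size T - k) = real (size M - k) * esym M k"
      using k T(1) coeff_linprod[of k M] by (simp add: coeff_pderiv Suc_diff_le flip: T(1))
    then have "real (size M) * esym T k = real (size M - k) * esym M k"
      using k T(2) by (simp add: coeff_linprod)
    moreover have "real (size M - k) * real (size M choose k) = real (size M) * real (size T choose k)"
      using binomial_absorb_comp[of "size M" k] T(1)
      by (metis diff_Suc_1 of_nat_mult)
    moreover have "real (size T choose k) > 0" "real (size M choose k) > 0" "real (size M) > 0"
      using k T(1) by auto
    ultimately show ?thesis
      unfolding mean_esym_def by (rule frac_eq_cross)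
  qed
  then show ?thesis using T(1) by blast
qed

text \<open>Reversal of coefficients: 1 + x t = x (1/x + t), so the generating function of
  \<open>M\<close> is the product of its elements times \<open>linprod\<close> of the
  inverses.\<close>

lemma esym_inverse:
  assumes "0 \<notin># M" "k \<le> size M"
  shows "esym M k = esym M (size M) * esym (image_mset inverse M) (size M - k)"
proof -
  have *: "(\<Prod>x\<in>#M. [:1, x:]) = Polynomial.smult (prod_mset M) (linprod (image_mset inverse M))"
    using assms(1)
  proof (induction M)
    case (add x M)
    have "[:1, x:] = Polynomial.smult x [:inverse x, 1:]" using add.prems by auto
    then have "(\<Prod>y\<in>#add_mset x M. [:1, y:]) = Polynomial.smult x [:inverse x, 1:]
        * Polynomial.smult (prod_mset M) (linprod (image_mset inverse M))"
      using add by (simp del: mult_pCons_left mult_smult_left mult_smult_right smult_pCons)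
    then show ?case
      by (simp add: mult.commute del: mult_pCons_left smult_pCons)
  qed simp
  have e: "esym M j = prod_mset M * esym (image_mset inverse M) (size M - j)" if "j \<le> size M" for j
    using coeff_linprod[of "size M - j" "image_mset inverse M"] that by (simp add: esym_def[of M] *)
  show ?thesis using e[OF assms(2)] e[of "size M"] by simp
qed

lemma mean_esym_inverse:
  assumes "0 \<notin># M" "k \<le> size M"
  shows "mean_esym M k = esym M (size M) * mean_esym (image_mset inverse M) (size M - k)"
  using esym_inverse[OF assms] binomial_symmetric[OF assms(2)] by (simp add: mean_esym_def)

text \<open>Differentiation keeps the means of index 1 and 2, so the claim descends to two elements,
  where it says (a - b)^2 >= 0.\<close>

lemma newton_1: "2 \<le> size M \<Longrightarrow> mean_esym M 2 \<le> (mean_esym M 1)\<^sup>2"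
proof (induction "size M" arbitrary: M)
  case (Suc n)
  show ?case
  proof (cases "n = 1")
    case True
    then obtain a N where N: "M = add_mset a N" "size N = 1"
      using Suc.hyps(2) by (metis size_eq_Suc_imp_eq_union size_add_mset Suc_inject)
    then obtain b where "M = {#a, b#}" using size_1_singleton_mset by blast
    moreover have "a * b * 4 \<le> (a + b)\<^sup>2"
      using zero_le_power2[of "a - b"] by (simp add: power2_eq_square algebra_simps)
    ultimately show ?thesis
      by (simp add: mean_esym_def esym_1 esym_add_mset_Suc esym_empty numeral_2_eq_2 power_divide)
  next
    case False
    then have n: "2 \<le> n" using Suc.prems Suc.hyps(2) by simp
    have "M \<noteq> {#}" using Suc.hyps(2) by auto
    from mean_esym_pderiv[OF this] obtain T where "Suc (size T) = size M" "\<forall>k\<le>size T. mean_esym T k = mean_esym M k"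
      by blast
    then show ?thesis using Suc.hyps n by (metis One_nat_def Suc_1 Suc_inject Suc_leD)
  qed
qed simp

text \<open>Passing to the derivative lowers the size until \<open>k + 2\<close> equals it, and then inverting the
  elements turns the claim into the case \<open>k = 0\<close>.\<close>
lemma newton: "mean_esym M k * mean_esym M (k + 2) \<le> (mean_esym M (k + 1))\<^sup>2"
proof (induction "size M" arbitrary: M rule: less_induct)
  case less
  consider "size M < k + 2" | "size M = k + 2" | "k + 2 < size M" by linarith
  then show ?case
  proof cases
    case 1
    then show ?thesis by (simp add: mean_esym_def esym_eq_0)
  next
    case 2
    show ?thesis
    proof (cases "0 \<in># M")
      case True
      \<comment> \<open>With k + 2 elements, the top elementary symmetric function is the full
        product; an element 0 makes it vanish, and the left-hand side with it.\<close>
      then obtain N where N: "M = add_mset 0 N" by (metis multi_member_split)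
      then have "mean_esym M (k + 2) = 0"
        using 2 by (simp add: mean_esym_def esym_add_mset_Suc esym_eq_0)
      then show ?thesis by simp
    next
      case False
      let ?N = "image_mset inverse M"
      have "mean_esym M k = esym M (size M) * mean_esym ?N 2"
        "mean_esym M (k + 1) = esym M (size M) * mean_esym ?N 1"
        "mean_esym M (k + 2) = esym M (size M) * mean_esym ?N 0"
        using mean_esym_inverse[OF False] 2 by simp_all
      moreover have "(esym M (size M))\<^sup>2 * mean_esym ?N 2 \<le> (esym M (size M))\<^sup>2 * (mean_esym ?N 1)\<^sup>2"
        by (rule mult_left_mono) (use newton_1[of ?N] 2 in simp_all)
      moreover have "mean_esym ?N 0 = 1" by (simp add: mean_esym_def)
      ultimately show ?thesis
        by (simp add: power_mult_distrib power2_eq_square[of "esym M (size M)"] mult_ac)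
    qed
  next
    case 3
    then have "M \<noteq> {#}" by auto
    from mean_esym_pderiv[OF this] obtain T where "Suc (size T) = size M" "\<forall>k\<le>size T. mean_esym T k = mean_esym M k"
      by blast
    then show ?thesis using less[of T] 3 by simp
  qed
qed

lemma Suc_times_binomial_Suc: "Suc k * (n choose Suc k) = (n - k) * (n choose k)"
  using binomial_absorption[of k n] binomial_absorb_comp[of n k] by simp

lemma newton_esym: "esym M k * esym M (k + 2) \<le> (esym M (k + 1))\<^sup>2"
proof (cases "k + 2 \<le> size M")
  case True
  define n where "n = size M"
  define a b c where "a = real (n choose k)" and "b = real (n choose (k + 1))"
    and "c = real (n choose (k + 2))"
  have pos: "a > 0" "b > 0" "c > 0" using True by (auto simp: a_def b_def c_def n_def)
  have "real (k + 1) * b = real (n - k) * a"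
    using arg_cong[OF Suc_times_binomial_Suc[of k n], of real] by (simp add: a_def b_def distrib_right)
  moreover have "real (k + 2) * c = real (n - k - 1) * b"
    using arg_cong[OF Suc_times_binomial_Suc[of "Suc k" n], of real] by (simp add: c_def b_def distrib_right)
  \<comment> \<open>Log-concavity of the binomial coefficients: the ratio of a c to b^2 is (k + 1)(n
    - k - 1) / ((k + 2)(n - k)), which is at most 1.\<close>
  ultimately have "(real (n - k) * real (k + 2)) * (a * c) = (real (k + 1) * real (n - k - 1)) * b\<^sup>2"
    by (simp add: power2_eq_square) (metis mult.assoc mult.commute)
  also have "\<dots> \<le> (real (n - k) * real (k + 2)) * b\<^sup>2"
    by (intro mult_right_mono) (auto simp: mult.commute[of "real (n - k)"] simp del: of_nat_add intro!: mult_mono)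
  finally have ac: "a * c \<le> b\<^sup>2"
    using True by (simp add: n_def)
  have "esym M k * esym M (k + 2) = (a * c) * (mean_esym M k * mean_esym M (k + 2))"
    using pos by (simp add: mean_esym_def a_def c_def n_def)
  also have "\<dots> \<le> (a * c) * (mean_esym M (k + 1))\<^sup>2"
    using newton pos by (intro mult_left_mono) auto
  also have "\<dots> \<le> b\<^sup>2 * (mean_esym M (k + 1))\<^sup>2"
    using ac by (intro mult_right_mono) auto
  also have "\<dots> = (esym M (k + 1))\<^sup>2"
    using pos by (simp add: mean_esym_def b_def n_def power_divide)
  finally show ?thesis .
qed (simp add: esym_eq_0)

section \<open>Consequences of positive elementary symmetric functions\<close>

text \<open>If e_j(M) > 0 but e_{j+1}(M) <= 0, positivity of e_{j+1} and e_{j+2} for the enlarged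
  multiset forces e_{j+1}(M)^2 < e_j(M) e_{j+2}(M), against Newton. The use of index j + 2 is why
  one level is lost.\<close>

lemma esym_remove_pos:
  assumes pos: "\<And>j. j \<le> Suc k \<Longrightarrow> esym (add_mset x M) j > 0" and "j \<le> k"
  shows "esym M j > 0"
  using assms(2)
proof (induction j)
  case (Suc j)
  have IH: "esym M j > 0" using Suc by simp
  have 1: "esym M (Suc j) + x * esym M j > 0"
    using pos[of "Suc j"] Suc.prems by (simp add: esym_add_mset_Suc)
  have 2: "esym M (Suc (Suc j)) + x * esym M (Suc j) > 0"
    using pos[of "Suc (Suc j)"] Suc.prems by (simp add: esym_add_mset_Suc)
  show ?case
  proof (rule ccontr)
    assume "\<not> esym M (Suc j) > 0"
    then have neg: "- esym M (Suc j) \<ge> 0" by simp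
    have "(- esym M (Suc j)) * (- esym M (Suc j)) \<le> (x * esym M j) * (- esym M (Suc j))"
      using 1 neg by (intro mult_right_mono) auto
    also have "\<dots> = esym M j * (- x * esym M (Suc j))" by simp
    also have "\<dots> < esym M j * esym M (Suc (Suc j))"
      using 2 IH by (intro mult_strict_left_mono) auto
    finally show False using newton_esym[of M j] by (simp add: power2_eq_square)
  qed
qed simp

text \<open>Elements outside \<open>A\<close> are removed one at a time, each costing one level of
  positivity. There are at most k - 1 of them, so positivity of e_1 remains when only
  \<open>A\<close> is left.\<close>

lemma sum_subset_pos:
  assumes "\<And>j. j \<le> k \<Longrightarrow> esym M j > 0" "1 \<le> k" "A \<subseteq># M" "size M < size A + k"
  shows "sum_mset A > 0"
  using assms
proof (induction k arbitrary: M)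
  case (Suc k)
  show ?case
  proof (cases "A = M")
    case True
    then show ?thesis using Suc.prems(1)[of "Suc 0"] by (simp add: esym_1)
  next
    case False
    \<comment> \<open>Taking \<open>x\<close> from the multiset difference keeps \<open>A\<close>
      contained in what remains, also when \<open>x\<close> occurs in \<open>A\<close>.\<close>
    then obtain x where x: "x \<in># M - A"
      using Suc.prems(3) by (metis multiset_nonemptyE Diff_eq_empty_iff_mset subset_mset.antisym)
    then obtain N where M: "M = add_mset x N" by (meson in_diffD multi_member_split)
    have A: "A \<subseteq># N"
    proof (rule mset_subset_eqI)
      fix y
      show "count A y \<le> count N y"
        using x mset_subset_eq_count[OF Suc.prems(3), of y] unfolding M
        by (cases "y = x") (auto simp: in_diff_count)
    qed
    have "k \<noteq> 0"
      using Suc.prems(4) size_mset_mono[OF A] unfolding M by auto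
    moreover have "esym N j > 0" if "j \<le> k" for j
      using esym_remove_pos[of k x N j] Suc.prems(1) that unfolding M by blast
    ultimately show ?thesis
      using Suc.IH[of N] A Suc.prems(4) unfolding M by simp
  qed
qed simp

text \<open>By Newton the ratios of consecutive means decrease, so each is at most the first one,
  which is the arithmetic mean.\<close>

lemma mean_esym_Suc_le:
  assumes "\<And>i. i \<le> j \<Longrightarrow> esym M i > 0" "j < size M"
  shows "mean_esym M (Suc j) \<le> mean_esym M j * mean_esym M 1"
  using assms
proof (induction j)
  case 0
  then show ?case by (simp add: mean_esym_def)
next
  case (Suc j)
  have pos: "mean_esym M j > 0" "mean_esym M (Suc j) > 0"
    using Suc.prems(1)[of j] Suc.prems(1)[of "Suc j"] Suc.prems(2) by (simp_all add: mean_esym_def)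
  have "mean_esym M j * mean_esym M (Suc (Suc j)) \<le> mean_esym M (Suc j) * mean_esym M (Suc j)"
    using newton[of M j] by (simp add: power2_eq_square)
  also have "\<dots> \<le> mean_esym M (Suc j) * (mean_esym M j * mean_esym M 1)"
    using Suc pos by (intro mult_left_mono) auto
  finally have "mean_esym M j * mean_esym M (Suc (Suc j)) \<le> mean_esym M j * (mean_esym M (Suc j) * mean_esym M 1)"
    by (simp add: mult_ac)
  then show ?case using pos by simp
qed

text \<open>Let N be M without x. Then 0 < e_k(M) = e_k(N) + x e_{k-1}(N), and
  \<open>mean_esym_Suc_le\<close> bounds e_k(N) by a multiple of e_{k-1}(N) times the mean of N.
  Dividing by e_{k-1}(N), positive by \<open>esym_remove_pos\<close>, leaves an inequality linear in
  x.\<close>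

lemma element_lower_bound:
  assumes pos: "\<And>j. j \<le> k \<Longrightarrow> esym M j > 0" and k: "1 \<le> k" "k < size M" and x: "x \<in># M"
  shows "real (size M - k) * sum_mset M + real (size M) * real (k - 1) * x > 0"
proof -
  obtain N where M: "M = add_mset x N" using x by (metis multi_member_split)
  obtain l where l: "k = Suc l" using k by (cases k) auto
  define m where "m = size N"
  have m: "k \<le> m" "size M = Suc m" using k M by (simp_all add: m_def)
  have N: "esym N j > 0" if "j \<le> l" for j
    using esym_remove_pos[of l x N j] pos that unfolding M l by blast
  have "0 < esym N k + x * esym N l"
    using pos[of k] by (simp add: M l esym_add_mset_Suc)
  moreover have "esym N k = real (m choose k) * mean_esym N k"
    using m by (simp add: mean_esym_def m_def)
  moreover have "mean_esym N k \<le> mean_esym N l * mean_esym N 1"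
    unfolding l using N m l by (intro mean_esym_Suc_le) (auto simp: m_def)
  then have "real (m choose k) * mean_esym N k \<le> real (m choose k) * (mean_esym N l * mean_esym N 1)"
    by (rule mult_left_mono) simp
  moreover have "mean_esym N 1 = sum_mset N / real m" by (simp add: mean_esym_def esym_1 m_def)
  ultimately have "esym N k \<le> real (m choose k) * (mean_esym N l * (sum_mset N / real m))"
    "0 < esym N k + x * esym N l"
    by (simp_all only:)
  then have "0 < real (m choose k) * (mean_esym N l * (sum_mset N / real m)) + x * esym N l"
    by linarith
  moreover have "real k * real (m choose k) = real (m - l) * real (m choose l)"
    using arg_cong[OF Suc_times_binomial_Suc[of l m], of real] by (simp add: l distrib_right)
  then have "real (m choose k) = real (m - l) / real k * real (m choose l)"
    using k(1) by (simp add: eq_divide_eq mult.commute)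
  moreover have "real (m choose l) * mean_esym N l = esym N l"
    using m l by (simp add: mean_esym_def m_def)
  ultimately have "real (m choose k) * mean_esym N l = real (m - l) / real k * esym N l"
    "0 < real (m choose k) * (mean_esym N l * (sum_mset N / real m)) + x * esym N l"
    by (metis mult.assoc)+
  then have "0 < esym N l * (real (m - l) / real k * (sum_mset N / real m) + x)"
    by (simp only: flip: mult.assoc) (simp add: algebra_simps)
  then have "0 < real (m - l) / real k * (sum_mset N / real m) + x"
    using N[of l] by (simp add: zero_less_mult_iff)
  then have "0 < real k * real m * (real (m - l) / real k * (sum_mset N / real m) + x)"
    using m l by (intro mult_pos_pos) auto
  also have "\<dots> = real (m - l) * sum_mset N + real k * real m * x"
  proof -
    have "real k * real m * (d / real k * (s / real m) + x) = d * s + real k * real m * x" for d s :: real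
      using m(1) k(1) by (simp add: field_simps)
    then show ?thesis .
  qed
  also have "\<dots> = real (size M - k) * sum_mset M + real (size M) * real (k - 1) * x"
  proof -
    \<comment> \<open>Replacing the sum of N by that of M minus x turns the coefficient of x into k
      m - (m - l) = (m + 1) l, as k = l + 1.\<close>
    have "(real m - real l) * s + (real l + 1) * real m * x
        = (real m - real l) * (x + s) + (real m + 1) * real l * x" for s
      by (simp add: algebra_simps)
    moreover have "sum_mset M = x + sum_mset N" "size M - k = m - l" "real (m - l) = real m - real l"
      "real (size M) = real m + 1" "real (k - 1) = real l" "real k = real l + 1"
      using m l by (simp_all add: M m_def)
    ultimately show ?thesis by (simp only:)
  qed
  finally show ?thesis .
qed

section \<open>The spectral theorem for real symmetric matrices\<close>

text \<open>For a complex eigenvector v with eigenvalue z, the number v* A v equals z |v|^2 and is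
  its own conjugate by symmetry, so z is a real root of the characteristic polynomial.\<close>

lemma real_symmetric_eigenvalue:
  fixes A :: "real mat"
  assumes A: "A \<in> carrier_mat n n" and sym: "transpose_mat A = A" and n: "0 < n"
  shows "\<exists>e. eigenvalue A e"
proof -
  let ?A = "map_mat complex_of_real A"
  have A': "?A \<in> carrier_mat n n" using A by simp
  obtain zs where zs: "char_poly ?A = (\<Prod>z\<leftarrow>zs. [:- z, 1:])" "length zs = n"
    using char_poly_factorized[OF A'] by blast
  define z where "z = hd zs"
  have "z \<in> set zs" using zs(2) n by (auto simp: z_def)
  then have root: "poly (char_poly ?A) z = 0"
    unfolding zs(1) by (auto simp: poly_prod_list prod_list_zero_iff)
  then obtain v where v: "v \<in> carrier_vec n" "v \<noteq> 0\<^sub>v n" "?A *\<^sub>v v = z \<cdot>\<^sub>v v"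
    using eigenvalue_root_char_poly[OF A'] A' by (auto simp: eigenvalue_def eigenvector_def)
  define a where "a i j = complex_of_real (A $$ (i, j))" for i j
  have a_sym: "a i j = a j i" if "i < n" "j < n" for i j
    using sym A that by (metis a_def carrier_matD index_transpose_mat(1))
  have ev: "(\<Sum>j<n. a i j * v $ j) = z * v $ i" if "i < n" for i
  proof -
    have "(?A *\<^sub>v v) $ i = (\<Sum>j<n. a i j * v $ j)"
      using A v(1) that by (simp add: a_def scalar_prod_def atLeast0LessThan)
    then show ?thesis using v that by simp
  qed
  define N where "N = (\<Sum>i<n. cnj (v $ i) * v $ i)"
  define S where "S = (\<Sum>i<n. cnj (v $ i) * (\<Sum>j<n. a i j * v $ j))"
  have "S = z * N"
    unfolding S_def N_def sum_distrib_left[of z] by (intro sum.cong refl, subst ev) (simp_all add: mult_ac)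
  moreover have "cnj S = S"
  proof -
    have "cnj S = (\<Sum>i<n. \<Sum>j<n. v $ i * (a i j * cnj (v $ j)))"
      by (simp add: S_def a_def sum_distrib_left)
    also have "\<dots> = (\<Sum>j<n. \<Sum>i<n. v $ i * (a i j * cnj (v $ j)))"
      by (rule sum.swap)
    also have "\<dots> = S"
      unfolding S_def sum_distrib_left by (intro sum.cong refl) (simp add: a_sym mult_ac)
    finally show ?thesis .
  qed
  moreover have N: "N = of_real (\<Sum>i<n. (cmod (v $ i))\<^sup>2)"
    unfolding N_def of_real_sum complex_norm_square by (simp add: mult.commute)
  moreover have "N \<noteq> 0"
  proof -
    obtain i where "i < n" "v $ i \<noteq> 0" using v by (metis eq_vecI carrier_vecD index_zero_vec)
    then have "(\<Sum>i<n. (cmod (v $ i))\<^sup>2) > 0"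
      by (intro sum_pos2[of _ i]) auto
    then show ?thesis unfolding N by (simp only: of_real_eq_0_iff)
  qed
  ultimately have "cnj z = z"
    by (metis complex_cnj_complex_of_real complex_cnj_mult mult_right_cancel)
  then obtain e where e: "z = of_real e" by (metis Reals_cases Reals_cnj_iff)
  have "char_poly ?A = map_poly of_real (char_poly A)"
    by (rule of_real_hom.char_poly_hom[OF A])
  then have "poly (char_poly A) e = 0" using root e by simp
  then show ?thesis using eigenvalue_root_char_poly[OF A] by blast
qed

text \<open>Complete v to a basis, apply Gram-Schmidt, which keeps the first vector, and normalise
  the columns; hence the scalar \<open>c\<close>.\<close>

lemma orthogonal_completion:
  fixes v :: "real vec"
  assumes v: "v \<in> carrier_vec n" "v \<noteq> 0\<^sub>v n"
  shows "\<exists>W c. W \<in> carrier_mat n n \<and> transpose_mat W * W = 1\<^sub>m n \<and> col W 0 = c \<cdot>\<^sub>v v"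
proof -
  have n: "n \<noteq> 0"
    using v by (metis carrier_vecD eq_vecI index_zero_vec(2) less_nat_zero_code)
  interpret cof_vec_space n "TYPE(real)" .
  define b where "b = basis_completion v"
  define ws where "ws = gram_schmidt n b"
  from basis_completion[OF v, folded b_def]
  have b: "distinct b" "\<not> lin_dep (set b)" "set b \<subseteq> carrier_vec n" "hd b = v" "length b = n"
    by auto
  then obtain vs where bv: "b = v # vs" using n by (cases b) auto
  from gram_schmidt_result[OF b(3,1,2) refl, folded ws_def]
  have ws: "set ws \<subseteq> carrier_vec n" "corthogonal ws" "length ws = n"
    by (auto simp: b)
  have "hd ws = v" using gram_schmidt_hd[OF v(1), of vs, folded bv] unfolding ws_def .
  then have ws0: "ws ! 0 = v" using ws n by (metis hd_conv_nth list.size(3))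
  have wsc: "ws ! i \<in> carrier_vec n" if "i < n" for i using ws that by auto
  have orth: "(ws ! i \<bullet> ws ! j = 0) = (i \<noteq> j)" if "i < n" "j < n" for i j
  proof -
    \<comment> \<open>Over the reals conjugation is trivial. The case i = j of the orthogonality
      statement also says that no vector has norm 0, as normalising requires.\<close>
    have "conjugate (ws ! j) = ws ! j" by (rule eq_vecI) auto
    then show ?thesis using corthogonalD[OF ws(2)] that ws(3) by metis
  qed
  define r where "r i = sqrt (ws ! i \<bullet> ws ! i)" for i
  have r: "r i * r i = ws ! i \<bullet> ws ! i" "r i \<noteq> 0" if "i < n" for i
  proof -
    have "ws ! i \<bullet> ws ! i \<ge> 0" by (auto simp: scalar_prod_def intro!: sum_nonneg)
    then show "r i * r i = ws ! i \<bullet> ws ! i" by (simp add: r_def)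
    show "r i \<noteq> 0" using orth[OF that that] by (simp add: r_def)
  qed
  define W where "W = mat n n (\<lambda>(i, j). ws ! j $ i / r j)"
  have W: "W \<in> carrier_mat n n" by (simp add: W_def)
  have "transpose_mat W * W = 1\<^sub>m n"
  proof (rule eq_matI)
    fix i j assume ij: "i < dim_row (1\<^sub>m n :: real mat)" "j < dim_col (1\<^sub>m n :: real mat)"
    then have "(transpose_mat W * W) $$ (i, j) = (\<Sum>k<n. (ws ! i $ k * ws ! j $ k) / (r i * r j))"
      by (simp add: W_def scalar_prod_def atLeast0LessThan)
    also have "\<dots> = (ws ! i \<bullet> ws ! j) / (r i * r j)"
      using carrier_vecD[OF wsc] ij by (simp add: scalar_prod_def atLeast0LessThan sum_divide_distrib)
    also have "\<dots> = 1\<^sub>m n $$ (i, j)"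
      using orth r ij by auto
    finally show "(transpose_mat W * W) $$ (i, j) = 1\<^sub>m n $$ (i, j)" .
  qed (simp_all add: W_def)
  moreover have "col W 0 = (1 / r 0) \<cdot>\<^sub>v v"
    using n v ws0 by (intro eq_vecI) (auto simp: W_def)
  ultimately show ?thesis using W by blast
qed

text \<open>Deflation: conjugating by an orthogonal matrix whose first column is an eigenvector
  splits off a 1 by 1 block, and the induction hypothesis diagonalises the other block.\<close>

lemma real_spectral:
  fixes A :: "real mat"
  assumes "A \<in> carrier_mat n n" "transpose_mat A = A"
  shows "\<exists>P D. P \<in> carrier_mat n n \<and> D \<in> carrier_mat n n \<and> transpose_mat P * P = 1\<^sub>m n \<and>
    diagonal_mat D \<and> A = P * D * transpose_mat P"
  using assms
proof (induction n arbitrary: A)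
  case 0
  then show ?case
    by (intro exI[of _ A]) (auto simp: diagonal_mat_def intro!: eq_matI)
next
  case (Suc n)
  note A = Suc.prems(1)
  obtain e v where v: "v \<in> carrier_vec (Suc n)" "v \<noteq> 0\<^sub>v (Suc n)" "A *\<^sub>v v = e \<cdot>\<^sub>v v"
    using real_symmetric_eigenvalue[OF Suc.prems] A by (auto simp: eigenvalue_def eigenvector_def)
  obtain W c where W: "W \<in> carrier_mat (Suc n) (Suc n)" "transpose_mat W * W = 1\<^sub>m (Suc n)"
      "col W 0 = c \<cdot>\<^sub>v v"
    using orthogonal_completion[OF v(1,2)] by blast
  have WT: "transpose_mat W \<in> carrier_mat (Suc n) (Suc n)" using W by simp
  have WW: "W * transpose_mat W = 1\<^sub>m (Suc n)"
    by (rule mat_mult_left_right_inverse[OF WT W(1,2)])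
  define A' where "A' = transpose_mat W * A * W"
  have A': "A' \<in> carrier_mat (Suc n) (Suc n)" using A W by (simp add: A'_def)
  have A_eq: "A = W * A' * transpose_mat W"
  proof -
    have "W * A' * transpose_mat W = (W * transpose_mat W) * A * (W * transpose_mat W)"
      unfolding A'_def using A W(1) WT
      by (simp add: assoc_mult_mat[of _ "Suc n" "Suc n" _ "Suc n" _ "Suc n"])
    then show ?thesis using A by (simp add: WW)
  qed
  have A'_sym: "transpose_mat A' = A'"
    unfolding A'_def using A W(1) WT
    by (simp add: transpose_mult[of _ "Suc n" "Suc n" _ "Suc n"] Suc.prems(2)
        assoc_mult_mat[of _ "Suc n" "Suc n" _ "Suc n" _ "Suc n"])
  have AW0: "A *\<^sub>v col W 0 = e \<cdot>\<^sub>v col W 0"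
    using A v by (simp add: W(3) mult_mat_vec[of _ "Suc n" "Suc n"] smult_smult_assoc mult.commute)
  \<comment> \<open>The first column is W^T A w = e W^T w for the first column w of W, and W^T w is
    the first unit vector. Symmetry will clear the first row as well.\<close>
  have A'_0: "A' $$ (i, 0) = (if i = 0 then e else 0)" if "i < Suc n" for i
  proof -
    have "A' = transpose_mat W * (A * W)"
      unfolding A'_def by (rule assoc_mult_mat[OF WT A W(1)])
    then have "A' $$ (i, 0) = row (transpose_mat W) i \<bullet> col (A * W) 0"
      using that W A by simp
    also have "\<dots> = col W i \<bullet> (e \<cdot>\<^sub>v col W 0)"
    proof -
      have "row (transpose_mat W) i = col W i" using that W(1) by simp
      moreover have "col (A * W) 0 = A *\<^sub>v col W 0" by (rule col_mult2[OF A W(1)]) simp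
      ultimately show ?thesis by (simp only: AW0)
    qed
    also have "\<dots> = e * (col W i \<bullet> col W 0)"
      using W(1) by (simp add: scalar_prod_smult_right)
    also have "col W i \<bullet> col W 0 = (transpose_mat W * W) $$ (i, 0)"
      using that W(1) by simp
    finally show ?thesis using that W(2) by simp
  qed
  define B where "B = mat n n (\<lambda>(i, j). A' $$ (Suc i, Suc j))"
  define E where "E = mat 1 1 (\<lambda>_. e)"
  have A'_block: "A' = four_block_mat E (0\<^sub>m 1 n) (0\<^sub>m n 1) B"
  proof (rule eq_matI)
    fix i j
    assume "i < dim_row (four_block_mat E (0\<^sub>m 1 n) (0\<^sub>m n 1) B)"
      and "j < dim_col (four_block_mat E (0\<^sub>m 1 n) (0\<^sub>m n 1) B)"
    then have ij: "i < Suc n" "j < Suc n" by (simp_all add: E_def B_def)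
    have "A' $$ (0, j) = A' $$ (j, 0)"
      using A'_sym A' ij by (metis carrier_matD index_transpose_mat(1) zero_less_Suc)
    then show "A' $$ (i, j) = four_block_mat E (0\<^sub>m 1 n) (0\<^sub>m n 1) B $$ (i, j)"
      using A'_0[OF ij(1)] A'_0[OF ij(2)] ij by (cases i; cases j) (auto simp: E_def B_def)
  qed (use A' in \<open>simp_all add: E_def B_def\<close>)
  have B: "B \<in> carrier_mat n n" by (simp add: B_def)
  have "transpose_mat B = B"
  proof (rule eq_matI)
    fix i j assume "i < dim_row B" "j < dim_col B"
    then have ij: "i < n" "j < n" by (simp_all add: B_def)
    have "A' $$ (Suc j, Suc i) = A' $$ (Suc i, Suc j)"
      using A'_sym A' ij by (metis carrier_matD index_transpose_mat(1) Suc_less_eq)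
    then show "transpose_mat B $$ (i, j) = B $$ (i, j)" using ij by (simp add: B_def)
  qed (simp_all add: B_def)
  from Suc.IH[OF B this] obtain P D where PD: "P \<in> carrier_mat n n" "D \<in> carrier_mat n n"
      "transpose_mat P * P = 1\<^sub>m n" "diagonal_mat D" "B = P * D * transpose_mat P"
    by blast
  have E: "E \<in> carrier_mat 1 1" by (simp add: E_def)
  let ?Q = "four_block_mat (1\<^sub>m 1) (0\<^sub>m 1 n) (0\<^sub>m n 1) P"
  let ?D = "four_block_mat E (0\<^sub>m 1 n) (0\<^sub>m n 1) D"
  have Q: "?Q \<in> carrier_mat (Suc n) (Suc n)" using PD by auto
  have D: "?D \<in> carrier_mat (Suc n) (Suc n)" using PD E by auto
  have QT: "transpose_mat ?Q = four_block_mat (1\<^sub>m 1) (0\<^sub>m 1 n) (0\<^sub>m n 1) (transpose_mat P)"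
    using PD by (subst transpose_four_block_mat) auto
  have PT: "transpose_mat P \<in> carrier_mat n n" using PD by simp
  have QQ: "transpose_mat ?Q * ?Q = 1\<^sub>m (Suc n)"
    unfolding QT using PD(1,3) PT
    by (subst mult_four_block_mat[of _ 1 1 _ n _ n _ _ 1 _ n]) (auto intro!: eq_matI)
  have QD: "?Q * ?D = four_block_mat E (0\<^sub>m 1 n) (0\<^sub>m n 1) (P * D)"
    using PD(1,2) E
    by (subst mult_four_block_mat[of _ 1 1 _ n _ n _ _ 1 _ n]) auto
  have A'_eq: "A' = ?Q * ?D * transpose_mat ?Q"
    unfolding QD QT A'_block PD(5) using PD(1,2) PT E
    by (subst mult_four_block_mat[of _ 1 1 _ n _ n _ _ 1 _ n]) auto
  have diag: "diagonal_mat ?D"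
    using PD(2,4) E unfolding diagonal_mat_def by (auto simp: E_def)
  have "transpose_mat (W * ?Q) * (W * ?Q) = transpose_mat ?Q * (transpose_mat W * W) * ?Q"
    using Q W(1) WT
    by (simp add: transpose_mult[of _ "Suc n" "Suc n" _ "Suc n"] 
        assoc_mult_mat[of _ "Suc n" "Suc n" _ "Suc n" _ "Suc n"])
  then have 1: "transpose_mat (W * ?Q) * (W * ?Q) = 1\<^sub>m (Suc n)"
    using right_mult_one_mat[of "transpose_mat ?Q" "Suc n" "Suc n"] Q
    by (simp only: W(2) QQ transpose_carrier_mat)
  have 2: "A = (W * ?Q) * ?D * transpose_mat (W * ?Q)"
    unfolding A_eq A'_eq using Q D W(1) WT
    by (simp add: transpose_mult[of _ "Suc n" "Suc n" _ "Suc n"] 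
        assoc_mult_mat[of _ "Suc n" "Suc n" _ "Suc n" _ "Suc n"])
  show ?case using 1 2 Q D W(1) diag by (intro exI[of _ "W * ?Q"] exI[of _ ?D]) auto
qed

section \<open>Elementary symmetric functions of the spectrum and their dependence on a
  shift\<close>

lemma prod_monom_1:
  "finite B \<Longrightarrow> (\<Prod>i\<in>B. monom (f i :: real) 1) = monom (prod f B) (card B)"
  by (induction B rule: finite_induct) (simp_all add: mult_monom)

text \<open>Expanding prod (1 + x_i t) over sets of positions, a set B contributes a monomial of
  degree \<open>card B\<close>. The order of the eigenvalue list thus becomes irrelevant.\<close>

lemma elem_sym_eq_esym: "elem_sym k xs = esym (mset xs) k"
proof -
  let ?n = "length xs"
  have "(\<Prod>x\<in>#mset xs. [:1, x:]) = (\<Prod>i<?n. [:1, xs ! i:])"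
    by (simp add: prod_mset_prod_list prod.list_conv_set_nth atLeast0LessThan flip: mset_map)
  also have "\<dots> = (\<Prod>i<?n. monom (xs ! i) 1 + 1)"
    by (intro prod.cong refl) (simp add: monom_altdef one_pCons)
  also have "\<dots> = (\<Sum>B\<in>Pow {..<?n}. \<Prod>i\<in>B. monom (xs ! i) 1)"
    by (subst prod_add) simp_all
  also have "\<dots> = (\<Sum>B\<in>Pow {..<?n}. monom (\<Prod>i\<in>B. xs ! i) (card B))"
    by (intro sum.cong refl prod_monom_1) (auto intro: finite_subset)
  finally have "esym (mset xs) k = (\<Sum>B\<in>Pow {..<?n}. if card B = k then \<Prod>i\<in>B. xs ! i else 0)"
    by (simp add: esym_def coeff_sum)
  also have "\<dots> = (\<Sum>B | B \<in> Pow {..<?n} \<and> card B = k. \<Prod>i\<in>B. xs ! i)"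
    by (rule sum.inter_filter[symmetric]) simp
  finally show ?thesis by (simp add: elem_sym_def)
qed

lemma sigma_eq_esym: "sigma k X = esym (proots (char_poly X)) k"
  by (simp add: sigma_def eigenvalue_list_def elem_sym_eq_esym)

lemma esym_replicate_1: "esym (replicate_mset n 1) k = real (n choose k)"
proof (induction n arbitrary: k)
  case (Suc n)
  then show ?case by (cases k) (simp_all add: esym_add_mset_Suc)
qed (simp add: esym_empty binomial_eq_0_iff)

lemma esym_pos:
  assumes "\<And>x. x \<in># M \<Longrightarrow> x > 0" "k \<le> size M"
  shows "esym M k > 0"
  using assms
proof (induction M arbitrary: k)
  case (add x M)
  show ?case
  proof (cases k)
    case (Suc j)
    then have "x * esym M j > 0" using add by simp
    moreover have "esym M k \<ge> 0"
      using add.IH[of k] add.prems(1) esym_eq_0[of M k] by (cases "k \<le> size M") (auto simp: less_imp_le)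
    ultimately show ?thesis by (simp add: Suc esym_add_mset_Suc)
  qed simp
qed simp

lemma higher_pderiv_linprod:
  assumes "j \<le> size M"
  shows "\<exists>T. size T = size M - j \<and>
    (pderiv ^^ j) (linprod M) = Polynomial.smult (fact (size M) / fact (size M - j)) (linprod T)"
  using assms
proof (induction j)
  case (Suc j)
  then obtain T where T: "size T = size M - j"
      "(pderiv ^^ j) (linprod M) = Polynomial.smult (fact (size M) / fact (size M - j)) (linprod T)"
    by auto
  have "T \<noteq> {#}" using T(1) Suc.prems by auto
  then obtain U where U: "Suc (size U) = size T" "pderiv (linprod T) = Polynomial.smult (real (size T)) (linprod U)"
    using pderiv_linprod by blast
  have "fact (size M - j) = real (size M - j) * fact (size M - Suc j)"
    using Suc.prems by (metis Suc_diff_Suc Suc_le_lessD fact_Suc)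
  then show ?case
    using T U Suc.prems by (intro exI[of _ U]) (auto simp: pderiv_smult)
qed auto

lemma higher_pderiv_pcompose_linear:
  "(pderiv ^^ j) (pcompose p [:s, 1:]) = pcompose ((pderiv ^^ j) p) [:s, 1 :: real:]"
  by (induction j) (simp_all add: pderiv_pcompose pderiv_pCons)

lemma linprod_shift: "linprod (image_mset ((+) s) M) = pcompose (linprod M) [:s, 1:]"
  by (induction M) (simp_all add: pcompose_mult pcompose_pCons pcompose_1 add.commute
      del: mult_pCons_left)

text \<open>As a function of the shift \<open>s\<close>, the \<open>k\<close>-th elementary symmetric function is, up to a constant,
  the \<open>(n - k)\<close>-th derivative of \<open>\<Prod>(s + x)\<close>, which splits by Gauss--Lucas.\<close>
lemma esym_shift:
  assumes k: "k \<le> size M"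
  shows "\<exists>T. (\<forall>s. esym (image_mset ((+) s) M) k = real (size M choose k) * (\<Prod>t\<in>#T. s + t)) \<and>
    ((\<forall>t\<in>#T. t > 0) \<longrightarrow> (\<forall>j\<le>k. esym M j > 0))"
proof -
  define n where "n = size M"
  define j where "j = n - k"
  obtain T where T: "size T = k"
      "(pderiv ^^ j) (linprod M) = Polynomial.smult (fact n / fact k) (linprod T)"
    using higher_pderiv_linprod[of j M] k by (auto simp: j_def n_def)
  have "esym (image_mset ((+) s) M) k = real (n choose k) * (\<Prod>t\<in>#T. s + t)" for s
  proof -
    let ?p = "pcompose (linprod M) [:s, 1:]"
    \<comment> \<open>By Taylor's formula, j! times coefficient j of the shifted polynomial is its
      j-th derivative at 0, which is that of \<open>linprod M\<close> at s.\<close>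
    have "fact j * esym (image_mset ((+) s) M) k = fact j * coeff ?p j"
      using coeff_linprod[of k "image_mset ((+) s) M"] k by (simp add: linprod_shift j_def n_def)
    also have "\<dots> = coeff ((pderiv ^^ j) ?p) 0"
      by (simp add: coeff_higher_pderiv pochhammer_fact)
    also have "\<dots> = poly ((pderiv ^^ j) (linprod M)) s"
      by (simp add: higher_pderiv_pcompose_linear)
    also have "\<dots> = fact n / fact k * (\<Prod>t\<in>#T. s + t)"
      by (simp add: T poly_linprod)
    also have "\<dots> = fact j * (real (n choose k) * (\<Prod>t\<in>#T. s + t))"
      using k by (simp add: binomial_fact n_def j_def)
    finally show ?thesis by simp
  qed
  \<comment> \<open>The top k + 1 coefficients of \<open>linprod M\<close> are positive multiples of
    those of \<open>linprod T\<close>, so positive \<open>T\<close> makes all of e_0, ..., e_k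
    positive, not only e_k.\<close>
  moreover have "esym M i > 0" if "\<forall>t\<in>#T. t > 0" "i \<le> k" for i
  proof -
    have "pochhammer (real (Suc (k - i))) j * coeff (linprod M) (k - i + j)
        = fact n / fact k * coeff (linprod T) (k - i)"
      using arg_cong[OF T(2), of "\<lambda>p. coeff p (k - i)"] by (simp add: coeff_higher_pderiv)
    moreover have "k - i + j = n - i" using that k by (simp add: j_def n_def)
    ultimately have "pochhammer (real (Suc (k - i))) j * esym M i = fact n / fact k * esym T i"
      using coeff_linprod[of i M] coeff_linprod[of i T] that k T by (simp add: n_def)
    moreover have "pochhammer (real (Suc (k - i))) j > 0" by (rule pochhammer_pos) simp
    moreover have "fact n / fact k * esym T i > 0" using esym_pos[of T i] that T by simp
    ultimately show ?thesis by (metis zero_less_mult_pos)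
  qed
  ultimately show ?thesis unfolding n_def by blast
qed

section \<open>The cone of \<open>\<sigma>\<^sub>k\<close>\<close>

text \<open>Two admissible multisets give polynomials that agree at every real s, hence are equal;
  this justifies the definite description.\<close>

lemma hyp_eigenvalues_eqI:
  assumes "p a \<noteq> 0" "\<And>s. p (s \<odot>\<^bsub>V\<^esub> a \<oplus>\<^bsub>V\<^esub> x) = p a * (\<Prod>t\<in>#M. s + t)"
  shows "hyp_eigenvalues V p a x = M"
  unfolding hyp_eigenvalues_def
proof (rule the_equality)
  fix N assume "\<forall>s. p (s \<odot>\<^bsub>V\<^esub> a \<oplus>\<^bsub>V\<^esub> x) = p a * (\<Prod>t\<in>#N. s + t)"
  then have "poly (linprod N) = poly (linprod M)"
    using assms by (auto simp: poly_linprod fun_eq_iff)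
  then show "N = M" using linprod_inject poly_eq_poly_eq_iff by blast
qed (use assms in auto)

lemma obtain_smallest:
  fixes e :: "'a \<Rightarrow> 'b :: linorder"
  assumes "finite A" "N \<le> card A"
  shows "\<exists>B\<subseteq>A. card B = N \<and> (\<forall>i\<in>B. \<forall>j\<in>A - B. e i \<le> e j)"
  using assms(2)
proof (induction N)
  case (Suc N)
  then obtain B where B: "B \<subseteq> A" "card B = N" "\<forall>i\<in>B. \<forall>j\<in>A - B. e i \<le> e j" by auto
  have fin: "finite B" "finite (A - B)" using B assms finite_subset by auto
  have "A - B \<noteq> {}" using B Suc.prems by auto
  then have "Min (e ` (A - B)) \<in> e ` (A - B)" using fin by (intro Min_in) auto
  then obtain x where "x \<in> A - B" "e x = Min (e ` (A - B))" by fastforce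
  then have x: "x \<in> A - B" "\<forall>y\<in>A - B. e x \<le> e y" using fin by auto
  then show ?case using B fin by (intro exI[of _ "insert x B"]) auto
qed (auto intro!: exI[of _ "{}"])

text \<open>The minimum of a linear function over weights in \<open>[0, 1]\<close> of total mass \<open>N\<close> is the sum of
  the \<open>N\<close> smallest values.\<close>
lemma weighted_sum_pos:
  fixes e w :: "'a \<Rightarrow> real"
  assumes fin: "finite A" and w: "\<And>j. j \<in> A \<Longrightarrow> 0 \<le> w j" "\<And>j. j \<in> A \<Longrightarrow> w j \<le> 1"
    and sum_w: "sum w A = real N" and N: "1 \<le> N" "N \<le> card A"
    and pos: "\<And>B. B \<subseteq> A \<Longrightarrow> card B = N \<Longrightarrow> sum e B > 0"
  shows "(\<Sum>j\<in>A. w j * e j) > 0"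
proof -
  obtain B where B: "B \<subseteq> A" "card B = N" "\<forall>i\<in>B. \<forall>j\<in>A - B. e i \<le> e j"
    using obtain_smallest[OF fin N(2)] by blast
  have finB: "finite B" and B_ne: "B \<noteq> {}" using B fin finite_subset N by auto
  \<comment> \<open>The difference \<open>e j - \<tau>\<close> is at most 0 on \<open>B\<close> and
    at least 0 off \<open>B\<close>, so weight 1 on \<open>B\<close> and 0 elsewhere is the cheapest
    choice. Subtracting \<tau> is harmless because both weightings have total mass
    \<open>N\<close>.\<close>
  define \<tau> where "\<tau> = Max (e ` B)"
  have \<tau>: "e i \<le> \<tau>" if "i \<in> B" for i
    using that finB by (simp add: \<tau>_def)
  have \<tau>': "\<tau> \<le> e j" if "j \<in> A - B" for j
    using that finB B_ne B(3) by (simp add: \<tau>_def)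
  have "(\<Sum>j\<in>B. e j - \<tau>) \<le> (\<Sum>j\<in>B. w j * (e j - \<tau>))"
  proof (rule sum_mono)
    fix j assume "j \<in> B"
    then have "w j \<le> 1" "e j - \<tau> \<le> 0" using w B \<tau> by (auto simp: subset_iff)
    then have "1 * (e j - \<tau>) \<le> w j * (e j - \<tau>)" by (rule mult_right_mono_neg)
    then show "e j - \<tau> \<le> w j * (e j - \<tau>)" by simp
  qed
  also have "\<dots> \<le> (\<Sum>j\<in>B. w j * (e j - \<tau>)) + (\<Sum>j\<in>A - B. w j * (e j - \<tau>))"
    using w \<tau>' by (auto intro!: sum_nonneg mult_nonneg_nonneg)
  also have "\<dots> = (\<Sum>j\<in>A. w j * (e j - \<tau>))"
    using sum.subset_diff[OF B(1) fin, of "\<lambda>j. w j * (e j - \<tau>)"] by simp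
  also have "\<dots> = (\<Sum>j\<in>A. w j * e j) - real N * \<tau>"
    by (simp add: right_diff_distrib sum_subtractf sum_w flip: sum_distrib_right)
  finally have "sum e B \<le> (\<Sum>j\<in>A. w j * e j)"
    by (simp add: sum_subtractf B)
  then show ?thesis using pos[OF B(1,2)] by simp
qed

lemma index_orthogonal_conj:
  assumes "P \<in> carrier_mat n n" "i < n" "j < n"
  shows "(P * mat_diag n f * transpose_mat P) $$ (i, j) = (\<Sum>l<n. P $$ (i, l) * f l * P $$ (j, l) :: real)"
  using assms by (simp add: mat_diag_mult_right[OF assms(1)] scalar_prod_def atLeast0LessThan)

lemma real_spectral_mat_diag:
  fixes A :: "real mat"
  assumes "A \<in> carrier_mat n n" "transpose_mat A = A"
  shows "\<exists>P f. P \<in> carrier_mat n n \<and> transpose_mat P * P = 1\<^sub>m n \<and>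
    A = P * mat_diag n f * transpose_mat P"
proof -
  obtain P D where PD: "P \<in> carrier_mat n n" "D \<in> carrier_mat n n" "transpose_mat P * P = 1\<^sub>m n"
      "diagonal_mat D" "A = P * D * transpose_mat P"
    using real_spectral[OF assms] by blast
  have "D = mat_diag n (\<lambda>i. D $$ (i, i))"
    using PD(2,4) by (intro eq_matI) (auto simp: mat_diag_def diagonal_mat_def)
  then show ?thesis using PD by metis
qed

lemma proots_char_poly_mat_diag:
  "proots (char_poly (mat_diag n f :: real mat)) = image_mset f (mset_set {..<n})"
proof -
  have "char_poly (mat_diag n f) = (\<Prod>a\<leftarrow>diag_mat (mat_diag n f). [:- a, 1:])"
    by (rule char_poly_upper_triangular[of _ n]) (auto simp: mat_diag_def)
  also have "diag_mat (mat_diag n f) = map f [0..<n]"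
    by (auto simp: diag_mat_def mat_diag_def)
  also have "(\<Prod>a\<leftarrow>map f [0..<n]. [:- a, 1:]) = linprod (image_mset (\<lambda>i. - f i) (mset_set {..<n}))"
    by (simp add: linprod_def comp_def multiset.map_comp flip: prod_mset_prod_list atLeast0LessThan)
  finally show ?thesis
    by (simp add: proots_linprod multiset.map_comp comp_def)
qed

lemma proots_char_poly_orthogonal_conj:
  fixes P :: "real mat"
  assumes P: "P \<in> carrier_mat n n" "transpose_mat P * P = 1\<^sub>m n"
  shows "proots (char_poly (P * mat_diag n f * transpose_mat P)) = image_mset f (mset_set {..<n})"
proof -
  have PT: "transpose_mat P \<in> carrier_mat n n" using P by simp
  have "similar_mat_wit (P * mat_diag n f * transpose_mat P) (mat_diag n f) P (transpose_mat P)"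
    using P PT by (intro similar_mat_witI[of _ _ n] mat_mult_left_right_inverse[OF PT P])
      (auto intro!: mult_carrier_mat[of _ n n])
  then show ?thesis
    using char_poly_similar proots_char_poly_mat_diag unfolding similar_mat_def by metis
qed

lemma carrier_sym_mats: "X \<in> carrier (sym_mats n) \<longleftrightarrow> X \<in> carrier_mat n n \<and> transpose_mat X = X"
  and add_sym_mats: "X \<oplus>\<^bsub>sym_mats n\<^esub> Y = X + Y"
  and smult_sym_mats: "c \<odot>\<^bsub>sym_mats n\<^esub> X = c \<cdot>\<^sub>m X"
  by (simp_all add: sym_mats_def module_mat_def)

lemma sigma_mat_diag: "sigma k (mat_diag n f) = elem_sym k (map f [0..<n])"
  by (simp add: sigma_eq_esym proots_char_poly_mat_diag elem_sym_eq_esym atLeast0LessThan)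

lemma one_mat_eq_mat_diag: "1\<^sub>m n = mat_diag n (\<lambda>_. 1 :: real)"
  by (rule eq_matI) (auto simp: mat_diag_def)

lemma sigma_one: "sigma k (1\<^sub>m n) = real (n choose k)"
  unfolding one_mat_eq_mat_diag sigma_eq_esym proots_char_poly_mat_diag
  by (simp add: image_mset_const_eq esym_replicate_1)

text \<open>These are the two facts about the cone that \<open>F\<close> needs: the first makes L_k
  positive, the second controls the entries that L_k omits.\<close>

lemma sigma_cone_diag:
  assumes k: "1 \<le> k" "k < n" and X: "X \<in> garding_cone (sym_mats n) (sigma k) (1\<^sub>m n)"
  shows "(\<Sum>i<n - k + 1. X $$ (i, i)) > 0"
    and "i < n \<Longrightarrow> real (n - k) * (\<Sum>i<n. X $$ (i, i)) + real n * real (k - 1) * X $$ (i, i) \<ge> 0"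
proof -
  have X_car: "X \<in> carrier_mat n n" "transpose_mat X = X"
    using X by (simp_all add: garding_cone_def carrier_sym_mats)
  obtain P f where P: "P \<in> carrier_mat n n" "transpose_mat P * P = 1\<^sub>m n"
      and X_eq: "X = P * mat_diag n f * transpose_mat P"
    using real_spectral_mat_diag[OF X_car] by blast
  have PT: "transpose_mat P \<in> carrier_mat n n" using P by simp
  have PPT: "P * transpose_mat P = 1\<^sub>m n"
    by (rule mat_mult_left_right_inverse[OF PT P])
  have row_orth: "(\<Sum>l<n. P $$ (i, l) * P $$ (j, l)) = (if i = j then 1 else 0)" if "i < n" "j < n" for i j
    using arg_cong[OF PPT, of "\<lambda>A. A $$ (i, j)"] that P(1) by (simp add: scalar_prod_def atLeast0LessThan)
  have col_norm: "(\<Sum>i<n. (P $$ (i, l))\<^sup>2) = 1" if "l < n" for l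
    using arg_cong[OF P(2), of "\<lambda>A. A $$ (l, l)"] that P(1)
    by (simp add: scalar_prod_def atLeast0LessThan power2_eq_square)
  define \<Lambda> where "\<Lambda> = image_mset f (mset_set {..<n})"
  have size_\<Lambda>: "size \<Lambda> = n" by (simp add: \<Lambda>_def)
  \<comment> \<open>The orthogonal matrix that diagonalises X also diagonalises s I + X, with every
    eigenvalue moved by s.\<close>
  have shift: "sigma k (s \<odot>\<^bsub>sym_mats n\<^esub> 1\<^sub>m n \<oplus>\<^bsub>sym_mats n\<^esub> X) = esym (image_mset ((+) s) \<Lambda>) k" for s
  proof -
    have "s \<cdot>\<^sub>m 1\<^sub>m n + X = P * mat_diag n (\<lambda>l. s + f l) * transpose_mat P" (is "?A = ?B")
    proof (rule eq_matI)
      fix i j assume "i < dim_row ?B" "j < dim_col ?B"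
      then have ij: "i < n" "j < n" using P by simp_all
      have "?B $$ (i, j) = s * (\<Sum>l<n. P $$ (i, l) * P $$ (j, l)) + (\<Sum>l<n. P $$ (i, l) * f l * P $$ (j, l))"
        unfolding index_orthogonal_conj[OF P(1) ij]
        by (simp add: distrib_left distrib_right sum.distrib sum_distrib_left mult_ac)
      also have "\<dots> = ?A $$ (i, j)"
        using row_orth[OF ij] index_orthogonal_conj[OF P(1) ij, of f] ij X_car by (simp flip: X_eq)
      finally show "?A $$ (i, j) = ?B $$ (i, j)" by simp
    qed (use P X_car in auto)
    then show ?thesis
      by (simp add: add_sym_mats smult_sym_mats sigma_eq_esym proots_char_poly_orthogonal_conj[OF P]
          \<Lambda>_def multiset.map_comp comp_def)
  qed
  obtain T where T: "\<And>s. esym (image_mset ((+) s) \<Lambda>) k = real (n choose k) * (\<Prod>t\<in>#T. s + t)"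
      "(\<forall>t\<in>#T. t > 0) \<Longrightarrow> (\<forall>j\<le>k. esym \<Lambda> j > 0)"
    using esym_shift[of k \<Lambda>] k size_\<Lambda> by auto
  have "hyp_eigenvalues (sym_mats n) (sigma k) (1\<^sub>m n) X = T"
    using k by (intro hyp_eigenvalues_eqI) (simp_all add: sigma_one shift T)
  then have pos: "esym \<Lambda> j > 0" if "j \<le> k" for j
    using X T(2) that by (auto simp: garding_cone_def)
  have diag: "X $$ (i, i) = (\<Sum>l<n. (P $$ (i, l))\<^sup>2 * f l)" if "i < n" for i
    using index_orthogonal_conj[OF P(1) that that, of f] by (simp flip: X_eq add: power2_eq_square mult_ac)
  have trace: "(\<Sum>i<n. X $$ (i, i)) = sum_mset \<Lambda>"
  proof -
    have "(\<Sum>i<n. X $$ (i, i)) = (\<Sum>i<n. \<Sum>l<n. (P $$ (i, l))\<^sup>2 * f l)"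
      by (intro sum.cong refl) (simp add: diag)
    also have "\<dots> = (\<Sum>l<n. \<Sum>i<n. (P $$ (i, l))\<^sup>2 * f l)"
      by (rule sum.swap)
    also have "\<dots> = (\<Sum>l<n. f l)"
      by (intro sum.cong refl) (simp add: col_norm flip: sum_distrib_right)
    finally show ?thesis by (simp add: \<Lambda>_def sum_unfold_sum_mset)
  qed
  let ?N = "n - k + 1"
  \<comment> \<open>The weight of eigenvalue l in the partial trace. Unit columns of P bound it by
    1, and unit rows give the total mass n - k + 1, as \<open>weighted_sum_pos\<close>
    requires.\<close>
  let ?w = "\<lambda>l. \<Sum>i<?N. (P $$ (i, l))\<^sup>2"
  have "(\<Sum>l<n. ?w l * f l) > 0"
  proof (rule weighted_sum_pos[where N = ?N])
    show "0 \<le> ?w l" for l by (intro sum_nonneg) simp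
    show "?w l \<le> 1" if "l \<in> {..<n}" for l
    proof -
      have "?w l \<le> (\<Sum>i<n. (P $$ (i, l))\<^sup>2)"
        using k by (intro sum_mono2) auto
      then show ?thesis using col_norm that by simp
    qed
    have "(\<Sum>l<n. ?w l) = (\<Sum>i<?N. \<Sum>l<n. (P $$ (i, l))\<^sup>2)"
      by (rule sum.swap)
    also have "\<dots> = (\<Sum>i<?N. 1)"
      using row_orth k by (intro sum.cong refl) (auto simp: power2_eq_square)
    finally show "(\<Sum>l<n. ?w l) = real ?N" by simp
    show "sum f B > 0" if "B \<subseteq> {..<n}" "card B = ?N" for B
    proof -
      have "image_mset f (mset_set B) \<subseteq># \<Lambda>"
        unfolding \<Lambda>_def using that(1) by (intro image_mset_subseteq_mono subset_imp_msubset_mset_set) auto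
      then have "sum_mset (image_mset f (mset_set B)) > 0"
        using that(2) k by (intro sum_subset_pos[of k \<Lambda>] pos) (auto simp: size_\<Lambda>)
      then show ?thesis by (simp add: sum_unfold_sum_mset)
    qed
  qed (use k in auto)
  also have "(\<Sum>l<n. ?w l * f l) = (\<Sum>l<n. \<Sum>i<?N. (P $$ (i, l))\<^sup>2 * f l)"
    by (simp only: sum_distrib_right)
  also have "\<dots> = (\<Sum>i<?N. \<Sum>l<n. (P $$ (i, l))\<^sup>2 * f l)"
    by (rule sum.swap)
  also have "\<dots> = (\<Sum>i<?N. X $$ (i, i))"
    using k by (intro sum.cong refl) (simp add: diag)
  finally show "(\<Sum>i<?N. X $$ (i, i)) > 0" .
  assume i: "i < n"
  \<comment> \<open>The bound is affine in the eigenvalue, so averaging with the squares of row i of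
    P, which sum to 1, carries it over to the diagonal entry.\<close>
  define c where "c = real (n - k) * sum_mset \<Lambda>"
  have "c + real n * real (k - 1) * f l \<ge> 0" if "l < n" for l
    using element_lower_bound[of k \<Lambda> "f l"] pos k that by (auto simp: c_def size_\<Lambda> \<Lambda>_def less_imp_le)
  then have "0 \<le> (\<Sum>l<n. (P $$ (i, l))\<^sup>2 * (c + real n * real (k - 1) * f l))"
    by (intro sum_nonneg mult_nonneg_nonneg) auto
  also have "\<dots> = (\<Sum>l<n. P $$ (i, l) * P $$ (i, l)) * c + real n * real (k - 1) * (\<Sum>l<n. (P $$ (i, l))\<^sup>2 * f l)"
    by (simp add: distrib_left sum.distrib sum_distrib_left sum_distrib_right power2_eq_square mult_ac)
  also have "\<dots> = c + real n * real (k - 1) * X $$ (i, i)"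
    using row_orth[OF i i] by (simp add: diag[OF i])
  finally show "real (n - k) * (\<Sum>i<n. X $$ (i, i)) + real n * real (k - 1) * X $$ (i, i) \<ge> 0"
    by (simp add: c_def trace)
qed

section \<open>The polynomial \<open>F\<close>\<close>

lemma Lk_form_vec:
  "1 \<le> k \<Longrightarrow> k \<le> n \<Longrightarrow> Lk_form n k (vec n f) = (\<Sum>i<n - k + 1. f i) / real (n - k + 1)"
  unfolding Lk_form_def by (intro arg_cong2[where f = "(/)"] sum.cong refl) simp

lemma L_form_vec:
  "1 \<le> k \<Longrightarrow> k \<le> n \<Longrightarrow> L_form n k q (vec n f)
    = 1 / (1 - q) * ((\<Sum>i<n. f i) / real n - q * ((\<Sum>i<n - k + 1. f i) / real (n - k + 1)))"
  unfolding L_form_def by (simp add: Lk_form_vec del: of_nat_add)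

text \<open>Both L_k and L take the value 1 at the all-ones vector, so adding s I adds s to each of
  them.\<close>

lemma F_poly_shift:
  assumes "1 \<le> k" "k \<le> n" "real r / real m \<noteq> 1" "X \<in> carrier_mat n n"
  shows "F_poly n k r m (s \<odot>\<^bsub>sym_mats n\<^esub> 1\<^sub>m n \<oplus>\<^bsub>sym_mats n\<^esub> X)
    = (s + Lk_form n k (vec n (\<lambda>i. X $$ (i, i)))) ^ r
      * (s + L_form n k (real r / real m) (vec n (\<lambda>i. X $$ (i, i)))) ^ (m - r)"
proof -
  define q where "q = real r / real m"
  define N where "N = n - k + 1"
  have nz: "1 - q \<noteq> 0" "real n \<noteq> 0" "real N \<noteq> 0" using assms by (auto simp: q_def N_def)
  have v: "vec n (\<lambda>i. (s \<odot>\<^bsub>sym_mats n\<^esub> 1\<^sub>m n \<oplus>\<^bsub>sym_mats n\<^esub> X) $$ (i, i)) = vec n (\<lambda>i. s + X $$ (i, i))"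
    using assms by (intro eq_vecI) (auto simp: add_sym_mats smult_sym_mats)
  have 1: "Lk_form n k (vec n (\<lambda>i. s + X $$ (i, i))) = s + Lk_form n k (vec n (\<lambda>i. X $$ (i, i)))"
    using nz unfolding Lk_form_vec[OF assms(1,2)] N_def[symmetric]
    by (simp add: sum.distrib add_divide_distrib)
  have "1 / (1 - q) * ((real n * s + a) / real n - q * ((real N * s + b) / real N))
      = s + 1 / (1 - q) * (a / real n - q * (b / real N))" for a b
    using nz by (simp add: add_divide_distrib) (simp add: field_simps)
  then have 2: "L_form n k q (vec n (\<lambda>i. s + X $$ (i, i))) = s + L_form n k q (vec n (\<lambda>i. X $$ (i, i)))"
    unfolding L_form_vec[OF assms(1,2)] N_def[symmetric] by (simp add: sum.distrib)
  show ?thesis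
    unfolding F_poly_def p_poly_def v 1 2[unfolded q_def] ..
qed

lemma linear_form_diag:
  assumes "1 \<le> k" "k \<le> n"
  shows "linear_form (sym_mats n) (\<lambda>X. Lk_form n k (vec n (\<lambda>i. X $$ (i, i))))"
    and "linear_form (sym_mats n) (\<lambda>X. L_form n k q (vec n (\<lambda>i. X $$ (i, i))))"
proof -
  have add: "(\<Sum>i<N. (X + Y) $$ (i, i)) = (\<Sum>i<N. X $$ (i, i)) + (\<Sum>i<N. Y $$ (i, i))"
    if "N \<le> n" "X \<in> carrier_mat n n" "Y \<in> carrier_mat n n" for N and X Y :: "real mat"
    unfolding sum.distrib[symmetric] using that by (intro sum.cong refl) simp
  have smult: "(\<Sum>i<N. (c \<cdot>\<^sub>m X) $$ (i, i)) = c * (\<Sum>i<N. X $$ (i, i))"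
    if "N \<le> n" "X \<in> carrier_mat n n" for N c and X :: "real mat"
    unfolding sum_distrib_left using that by (intro sum.cong refl) simp
  define N where "N = n - k + 1"
  have N: "N \<le> n" using assms by (simp add: N_def)
  show "linear_form (sym_mats n) (\<lambda>X. Lk_form n k (vec n (\<lambda>i. X $$ (i, i))))"
    unfolding linear_form_def Lk_form_vec[OF assms] N_def[symmetric]
    by (auto simp: add_sym_mats smult_sym_mats carrier_sym_mats add[OF N] smult[OF N] add_divide_distrib)
  show "linear_form (sym_mats n) (\<lambda>X. L_form n k q (vec n (\<lambda>i. X $$ (i, i))))"
    unfolding linear_form_def L_form_vec[OF assms] N_def[symmetric]
    by (auto simp: add_sym_mats smult_sym_mats carrier_sym_mats add[OF N] smult[OF N]
        add[OF order_refl] smult[OF order_refl] add_divide_distrib diff_divide_distrib algebra_simps)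
qed

lemma hyp_eigenvalues_F_poly:
  assumes "1 \<le> k" "k \<le> n" "real r / real m \<noteq> 1" "X \<in> carrier_mat n n" "F_poly n k r m (1\<^sub>m n) = 1"
  shows "hyp_eigenvalues (sym_mats n) (F_poly n k r m) (1\<^sub>m n) X
    = replicate_mset r (Lk_form n k (vec n (\<lambda>i. X $$ (i, i))))
      + replicate_mset (m - r) (L_form n k (real r / real m) (vec n (\<lambda>i. X $$ (i, i))))"
  using assms(5) by (intro hyp_eigenvalues_eqI) (simp_all add: F_poly_shift[OF assms(1-4)])

lemma F_poly_one:
  assumes "1 \<le> k" "k \<le> n" "real r / real m \<noteq> 1"
  shows "F_poly n k r m (1\<^sub>m n) = 1"
proof -
  have "vec n (\<lambda>i. 1\<^sub>m n $$ (i, i)) = vec n (\<lambda>_. 1 :: real)" by (rule eq_vecI) auto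
  then show ?thesis
    using assms unfolding F_poly_def p_poly_def
    by (simp add: Lk_form_vec L_form_vec del: of_nat_add Suc_eq_plus1)
qed

text \<open>\<open>F\<close> is a single product of m linear forms, each equal to 1 at the identity,
  so along s I + X it visibly splits into real linear factors.\<close>

lemma hyperbolic_F_poly:
  assumes "1 \<le> k" "k \<le> n" "r < m"
  shows "hyperbolic_polynomial (sym_mats n) m (F_poly n k r m) (1\<^sub>m n)"
  unfolding hyperbolic_polynomial_def
proof (intro conjI ballI)
  let ?q = "real r / real m"
  let ?Lk = "\<lambda>X :: real mat. Lk_form n k (vec n (\<lambda>i. X $$ (i, i)))"
  let ?L = "\<lambda>X :: real mat. L_form n k ?q (vec n (\<lambda>i. X $$ (i, i)))"
  have q: "?q \<noteq> 1" using assms by simp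
  show "1 \<le> m" using assms by simp
  show "1\<^sub>m n \<in> carrier (sym_mats n)" by (simp add: carrier_sym_mats)
  show "F_poly n k r m (1\<^sub>m n) > 0" using F_poly_one assms q by simp
  have "(\<Prod>j<m. if j < r then a else b) = a ^ r * b ^ (m - r)" for a b :: real
  proof -
    have "{..<m} = {..<r} \<union> {r..<m}" using assms by auto
    then show ?thesis by (simp add: prod.union_disjoint ivl_disj_int)
  qed
  then have "F_poly n k r m X = (\<Sum>i<1::nat. 1 * (\<Prod>j<m. (if j < r then ?Lk else ?L) X))" for X
    by (simp add: F_poly_def p_poly_def if_distribR cong: if_cong)
  then show "homogeneous_polynomial (sym_mats n) m (F_poly n k r m)"
    unfolding homogeneous_polynomial_def using linear_form_diag[OF assms(1,2)]
    by (intro exI[of _ 1] exI[of _ "\<lambda>_. 1"] exI[of _ "\<lambda>_ j. if j < r then ?Lk else ?L"]) auto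
  fix X assume "X \<in> carrier (sym_mats n)"
  then have "X \<in> carrier_mat n n" by (simp add: carrier_sym_mats)
  then show "\<exists>P. (\<forall>s. poly P s = F_poly n k r m (s \<odot>\<^bsub>sym_mats n\<^esub> 1\<^sub>m n \<oplus>\<^bsub>sym_mats n\<^esub> X)) \<and>
      (\<forall>z. poly (map_poly complex_of_real P) z = 0 \<longrightarrow> z \<in> \<real>)"
    by (intro exI[of _ "linprod (replicate_mset r (?Lk X) + replicate_mset (m - r) (?L X))"] conjI
        allI impI linprod_complex_root_real)
      (auto simp: F_poly_shift[OF assms(1,2) q] poly_linprod)
qed

text \<open>L is built so that q L_k + (1 - q) L is the mean of the coordinates; since r = q m, the
  trace is m times this mean, giving \<kappa> = m/n.\<close>

lemma central_hyperbolic_F_poly: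
  assumes "1 \<le> k" "k \<le> n" "r < m"
  shows "central_hyperbolic n m (F_poly n k r m)"
  unfolding central_hyperbolic_def
proof (intro conjI exI[of _ "real m / real n"] ballI)
  show "hyperbolic_polynomial (sym_mats n) m (F_poly n k r m) (1\<^sub>m n)"
    by (rule hyperbolic_F_poly[OF assms])
  show "real m / real n > 0" using assms by simp
  fix X assume "X \<in> carrier (sym_mats n)"
  then have X: "X \<in> carrier_mat n n" by (simp add: carrier_sym_mats)
  define q where "q = real r / real m"
  have q: "q \<noteq> 1" using assms by (simp add: q_def)
  let ?v = "vec n (\<lambda>i. X $$ (i, i))"
  have "hyp_trace (sym_mats n) (F_poly n k r m) (1\<^sub>m n) X
      = real r * Lk_form n k ?v + real (m - r) * L_form n k q ?v"
    using q F_poly_one[OF assms(1,2)] unfolding hyp_trace_def q_def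
    by (simp add: hyp_eigenvalues_F_poly[OF assms(1,2) _ X])
  also have "\<dots> = real m * (q * Lk_form n k ?v + (1 - q) * L_form n k q ?v)"
    using assms by (simp add: q_def of_nat_diff field_simps)
  also have "q * Lk_form n k ?v + (1 - q) * L_form n k q ?v = (\<Sum>i<n. ?v $ i) / real n"
    using q by (simp add: L_form_def)
  also have "(\<Sum>i<n. ?v $ i) = mat_trace X"
    using X by (simp add: mat_trace_def diag_mat_def interv_sum_list_conv_sum_set_nat atLeast0LessThan)
  finally show "hyp_trace (sym_mats n) (F_poly n k r m) (1\<^sub>m n) X = real m / real n * mat_trace X"
    by simp
qed

text \<open>With S the sum of the first N = n - k + 1 diagonal entries, L > 0 means q S / N < tr /
  n. The cone bounds yield S > 0 and n S <= (2n - k) tr, and q (2n - k) < N closes the gap.\<close>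

lemma sigma_cone_subset_F_cone:
  fixes q :: real
  assumes k: "2 \<le> k" "k < n" and r: "r < m" and q: "q = real r / real m"
    and q_less: "q < real (n - k + 1) / real (2 * n - k)"
  shows "garding_cone (sym_mats n) (sigma k) (1\<^sub>m n)
    \<subseteq> garding_cone (sym_mats n) (F_poly n k r m) (1\<^sub>m n)"
proof
  fix X assume X: "X \<in> garding_cone (sym_mats n) (sigma k) (1\<^sub>m n)"
  then have X_car: "X \<in> carrier (sym_mats n)" "X \<in> carrier_mat n n"
    by (simp_all add: garding_cone_def carrier_sym_mats)
  have k': "1 \<le> k" "k \<le> n" using k by simp_all
  have q1: "q < 1" and q': "real r / real m \<noteq> 1" using r q by simp_all
  define N where "N = n - k + 1"
  define S where "S = (\<Sum>i<N. X $$ (i, i))"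
  define tr where "tr = (\<Sum>i<n. X $$ (i, i))"
  have S: "S > 0" using sigma_cone_diag(1)[OF k'(1) k(2) X] by (simp add: S_def N_def)
  \<comment> \<open>Summing over the last k - 1 indices produces a common factor k - 1, positive as
    k >= 2; cancelling it leaves (n - k) tr + n (tr - S) >= 0.\<close>
  have "0 \<le> (\<Sum>i=N..<n. real (n - k) * tr + real n * real (k - 1) * X $$ (i, i))"
    unfolding tr_def by (intro sum_nonneg sigma_cone_diag(2)[OF k'(1) k(2) X]) simp
  also have "\<dots> = real (k - 1) * (real (n - k) * tr + real n * (\<Sum>i=N..<n. X $$ (i, i)))"
  proof -
    have "(\<Sum>i=N..<n. c + d * X $$ (i, i)) = real (k - 1) * c + d * (\<Sum>i=N..<n. X $$ (i, i))" for c d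
      using k by (simp add: sum.distrib sum_distrib_left N_def)
    then have "(\<Sum>i=N..<n. real (n - k) * tr + real n * real (k - 1) * X $$ (i, i))
        = real (k - 1) * (real (n - k) * tr) + real n * real (k - 1) * (\<Sum>i=N..<n. X $$ (i, i))" .
    then show ?thesis by (simp only: distrib_left mult_ac)
  qed
  also have "(\<Sum>i=N..<n. X $$ (i, i)) = tr - S"
  proof -
    have "{..<n} = {..<N} \<union> {N..<n}" using k by (auto simp: N_def)
    then show ?thesis unfolding tr_def S_def by (simp add: sum.union_disjoint ivl_disj_int)
  qed
  finally have "0 \<le> real (n - k) * tr + real n * (tr - S)"
    using k by (simp add: zero_le_mult_iff)
  then have tr_ge: "real n * S \<le> real (2 * n - k) * tr"
    using k by (simp add: of_nat_diff algebra_simps)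
  have pos: "real (2 * n - k) > 0" "real N > 0" "real n > 0" using k by (auto simp: N_def)
  have "q * real (2 * n - k) < real N"
    using q_less pos by (simp add: N_def field_simps)
  then have "q * real (2 * n - k) * (real n * S) < real N * (real n * S)"
    using S pos by (intro mult_strict_right_mono) auto
  also have "\<dots> \<le> real N * (real (2 * n - k) * tr)"
    using tr_ge pos by (intro mult_left_mono) auto
  finally have "real (2 * n - k) * (q * (real n * S)) < real (2 * n - k) * (real N * tr)"
    by (simp only: mult_ac)
  then have "q * (real n * S) < real N * tr" using pos by simp
  then have "q * (S / real N) < tr / real n" using pos by (simp add: field_simps)
  then have L: "L_form n k q (vec n (\<lambda>i. X $$ (i, i))) > 0"
    using q1 unfolding L_form_vec[OF k'] N_def[symmetric] S_def[symmetric] tr_def[symmetric] by simp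
  have Lk: "Lk_form n k (vec n (\<lambda>i. X $$ (i, i))) > 0"
    using S pos unfolding Lk_form_vec[OF k'] N_def[symmetric] S_def[symmetric] by simp
  show "X \<in> garding_cone (sym_mats n) (F_poly n k r m) (1\<^sub>m n)"
    using L Lk X_car(1) unfolding garding_cone_def q
    by (auto simp: hyp_eigenvalues_F_poly[OF k' q' X_car(2) F_poly_one[OF k' q']] split: if_splits)
qed

section \<open>Failure of majorization at the matrices \<open>X_eps\<close>\<close>

lemma pos_def_X_eps:
  assumes "\<epsilon> > 0"
  shows "pos_def_mat n (X_eps n k \<epsilon>)"
  unfolding pos_def_mat_def
proof (intro conjI ballI impI)
  show "X_eps n k \<epsilon> \<in> carrier (sym_mats n)"
    unfolding carrier_sym_mats X_eps_def by (auto simp: mat_diag_def intro!: eq_matI)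
  fix v :: "real vec" assume v: "v \<in> carrier_vec n" "v \<noteq> 0\<^sub>v n"
  define f where "f i = (if i < n - k + 1 then \<epsilon> else 1)" for i
  have f: "f i > 0" for i using assms by (simp add: f_def)
  have X: "X_eps n k \<epsilon> = mat_diag n f" by (simp add: X_eps_def f_def[abs_def])
  have "(X_eps n k \<epsilon> *\<^sub>v v) $ i = f i * v $ i" if "i < n" for i
  proof -
    have "(X_eps n k \<epsilon> *\<^sub>v v) $ i = (\<Sum>j<n. (if i = j then f j else 0) * v $ j)"
      using that v(1) by (simp add: X mat_diag_def scalar_prod_def atLeast0LessThan)
    also have "\<dots> = f i * v $ i"
      using that by (simp add: if_distrib[of "\<lambda>x. x * _"] cong: if_cong)
    finally show ?thesis .
  qed
  then have "v \<bullet> (X_eps n k \<epsilon> *\<^sub>v v) = (\<Sum>i<n. v $ i * (f i * v $ i))"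
    by (simp add: scalar_prod_def atLeast0LessThan X_eps_def mat_diag_def)
  also have "\<dots> = (\<Sum>i<n. f i * (v $ i)\<^sup>2)"
    by (simp add: power2_eq_square mult_ac)
  also have "\<dots> > 0"
  proof -
    obtain i where "i < n" "v $ i \<noteq> 0" using v by (metis eq_vecI carrier_vecD index_zero_vec)
    then show ?thesis
      using f by (intro sum_pos2[of _ i]) (auto simp: less_imp_le)
  qed
  finally show "v \<bullet> (X_eps n k \<epsilon> *\<^sub>v v) > 0" .
qed

lemma sigma_X_eps_ge:
  assumes "\<epsilon> > 0" "1 \<le> k" "k \<le> n"
  shows "\<epsilon> \<le> sigma k (X_eps n k \<epsilon>)"
proof -
  let ?N = "n - k + 1"
  define f where "f i = (if i < ?N then \<epsilon> else 1)" for i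
  \<comment> \<open>One position with entry \<epsilon> and all k - 1 positions with entry 1: this
    single term of \<sigma>_k is already \<epsilon>, and the others are nonnegative.\<close>
  define I where "I = insert 0 {?N..<n}"
  have "sigma k (X_eps n k \<epsilon>) = (\<Sum>I | I \<subseteq> {..<n} \<and> card I = k. \<Prod>i\<in>I. map f [0..<n] ! i)"
    unfolding X_eps_def sigma_mat_diag elem_sym_def by (simp add: f_def[abs_def])
  also have "\<dots> \<ge> (\<Prod>i\<in>I. map f [0..<n] ! i)"
  proof (rule member_le_sum)
    show "I \<in> {I. I \<subseteq> {..<n} \<and> card I = k}"
      using assms by (auto simp: I_def)
    show "finite {I. I \<subseteq> {..<n} \<and> card I = k}"
      by (rule finite_subset[of _ "Pow {..<n}"]) auto
    show "0 \<le> (\<Prod>i\<in>J. map f [0..<n] ! i)" if "J \<in> {I. I \<subseteq> {..<n} \<and> card I = k} - {I}" for J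
      using that assms by (intro prod_nonneg) (auto simp: f_def subset_iff)
  qed
  also have "(\<Prod>i\<in>I. map f [0..<n] ! i) = \<epsilon>"
    using assms by (simp add: I_def f_def)
  finally show ?thesis .
qed

text \<open>Here L_k is exactly \<epsilon>. The mean of the entries lies between N \<epsilon> / n
  and 1 for N = n - k + 1, so q < N / n makes L nonnegative and L <= 1 / (1 - q).\<close>

lemma F_poly_X_eps:
  fixes q :: real
  assumes "1 \<le> k" "k \<le> n" and r: "0 < r" "r < m" and q: "q = real r / real m"
    and q_less: "q < real (n - k + 1) / real n" and \<epsilon>: "0 < \<epsilon>" "\<epsilon> \<le> 1"
  shows "0 \<le> F_poly n k r m (X_eps n k \<epsilon>)"
    and "F_poly n k r m (X_eps n k \<epsilon>) \<le> \<epsilon> ^ r * (1 / (1 - q)) ^ m"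
proof -
  define N where "N = n - k + 1"
  define f where "f i = (if i < N then \<epsilon> else 1)" for i
  have q01: "0 < q" "q < 1" using r q by auto
  have pos: "real n > 0" "real N > 0" "N \<le> n" using assms(1,2) by (auto simp: N_def)
  have v: "vec n (\<lambda>i. X_eps n k \<epsilon> $$ (i, i)) = vec n f"
    by (rule eq_vecI) (auto simp: X_eps_def mat_diag_def f_def N_def)
  have sum_N: "(\<Sum>i<N. f i) = real N * \<epsilon>" by (simp add: f_def)
  define S where "S = (\<Sum>i<n. f i)"
  have S_le: "S \<le> real n"
    using sum_mono[of "{..<n}" f "\<lambda>_. 1"] \<epsilon> by (auto simp: S_def f_def)
  have S_ge: "S \<ge> real N * \<epsilon>"
    unfolding S_def sum_N[symmetric] using pos \<epsilon> by (intro sum_mono2) (auto simp: f_def)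
  have Lk: "Lk_form n k (vec n f) = \<epsilon>"
    using sum_N pos unfolding Lk_form_vec[OF assms(1,2)] N_def[symmetric] by simp
  have L: "L_form n k q (vec n f) = 1 / (1 - q) * (S / real n - q * \<epsilon>)"
    using sum_N pos unfolding L_form_vec[OF assms(1,2)] N_def[symmetric] S_def by simp
  have "q * \<epsilon> \<le> real N / real n * \<epsilon>"
    using q_less \<epsilon> by (intro mult_right_mono) (auto simp: N_def)
  also have "\<dots> \<le> S / real n" using S_ge pos by (simp add: divide_right_mono)
  finally have "S / real n - q * \<epsilon> \<ge> 0" by simp
  moreover have "S / real n - q * \<epsilon> \<le> 1"
  proof -
    have "S / real n \<le> 1" using S_le pos by simp
    moreover have "0 \<le> q * \<epsilon>" using q01 \<epsilon> by simp
    ultimately show ?thesis by linarith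
  qed
  ultimately have L_bounds: "0 \<le> L_form n k q (vec n f)" "L_form n k q (vec n f) \<le> 1 / (1 - q)"
    unfolding L using q01 by (auto intro!: divide_nonneg_pos divide_right_mono)
  have F: "F_poly n k r m (X_eps n k \<epsilon>) = \<epsilon> ^ r * L_form n k q (vec n f) ^ (m - r)"
    unfolding F_poly_def p_poly_def v Lk q ..
  show "0 \<le> F_poly n k r m (X_eps n k \<epsilon>)" unfolding F using L_bounds \<epsilon> by simp
  have "L_form n k q (vec n f) ^ (m - r) \<le> (1 / (1 - q)) ^ (m - r)"
    using L_bounds by (intro power_mono)
  \<comment> \<open>The base is at least 1, so the exponent may be raised to m, which gives a
    simpler constant.\<close>
  also have "\<dots> \<le> (1 / (1 - q)) ^ m"
    using q01 by (intro power_increasing) auto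
  finally show "F_poly n k r m (X_eps n k \<epsilon>) \<le> \<epsilon> ^ r * (1 / (1 - q)) ^ m"
    unfolding F using \<epsilon> by (intro mult_left_mono) auto
qed

theorem mainTheorem5:
  fixes n k r m :: nat and q :: real
  assumes "3 \<le> k" and "k \<le> n - 1"
    and "0 < r" and "0 < m" and "q = real r / real m"
    and "1 / real k < q" and "q < real (n - k + 1) / real (2 * n - k)"
  shows "central_hyperbolic n m (F_poly n k r m)
    \<and> garding_cone (sym_mats n) (sigma k) (1\<^sub>m n)
        \<subseteq> garding_cone (sym_mats n) (F_poly n k r m) (1\<^sub>m n)
    \<and> (\<forall>\<^sub>F \<epsilon> in at_right 0.
         pos_def_mat n (X_eps n k \<epsilon>) \<and> diagonal_mat (X_eps n k \<epsilon>)
         \<and> root m (F_poly n k r m (X_eps n k \<epsilon>))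
             < root m (F_poly n k r m (1\<^sub>m n))
               * root k (sigma k (X_eps n k \<epsilon>) / real (n choose k)))"
proof (intro conjI)
  have k: "1 \<le> k" "2 \<le> k" "k \<le> n" "k < n" using assms(1,2) by simp_all
  \<comment> \<open>Since 2n - k >= n, the assumed upper bound on q also yields q < (n - k + 1) / n,
    and from it q < 1 and r < m.\<close>
  have "real (n - k + 1) / real (2 * n - k) \<le> real (n - k + 1) / real n"
    using k by (intro divide_left_mono) (auto simp del: of_nat_diff)
  then have q_less: "q < real (n - k + 1) / real n" using assms(7) by (rule order.strict_trans2[rotated])
  also have "\<dots> \<le> 1" using k by (simp del: of_nat_add of_nat_diff)
  finally have q1: "q < 1" .
  have r: "r < m" using q1 assms(4,5) by simp
  show "central_hyperbolic n m (F_poly n k r m)"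
    by (rule central_hyperbolic_F_poly[OF k(1,3) r])
  show "garding_cone (sym_mats n) (sigma k) (1\<^sub>m n)
      \<subseteq> garding_cone (sym_mats n) (F_poly n k r m) (1\<^sub>m n)"
    by (rule sigma_cone_subset_F_cone[OF k(2,4) r assms(5,7)])
  define C where "C = real (n choose k)"
  \<comment> \<open>Chosen so that \<epsilon>^(m+1) / (1 - q)^(m k) equals (\<epsilon> / C)^m times
    K \<epsilon>; the comparison is then strict as soon as \<epsilon> < 1 / K.\<close>
  define K where "K = (1 / (1 - q)) ^ (m * k) * C ^ m"
  have C: "C > 0" using k by (simp add: C_def)
  have K: "K > 0" using C q1 by (simp add: K_def)
  \<comment> \<open>The bound q > 1/k says m < r k; between integers this leaves at least one spare
    factor \<epsilon>.\<close>
  have rk: "Suc m \<le> r * k"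
  proof -
    have "1 / real k < real r / real m" using assms(5,6) by simp
    then have "real m < real r * real k" using assms(1,4) by (simp add: field_simps)
    then have "m < r * k" by (metis of_nat_less_iff of_nat_mult)
    then show ?thesis by simp
  qed
  have "\<forall>\<^sub>F \<epsilon> in at_right 0. \<epsilon> < min 1 (1 / K) \<and> (0 :: real) < \<epsilon>"
    using K by (intro eventually_conj eventually_at_right_less eventually_at_rightI[of 0 "min 1 (1 / K)"]) auto
  then show "\<forall>\<^sub>F \<epsilon> in at_right 0.
         pos_def_mat n (X_eps n k \<epsilon>) \<and> diagonal_mat (X_eps n k \<epsilon>)
         \<and> root m (F_poly n k r m (X_eps n k \<epsilon>))
             < root m (F_poly n k r m (1\<^sub>m n))
               * root k (sigma k (X_eps n k \<epsilon>) / real (n choose k))"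
  proof eventually_elim
    case (elim \<epsilon>)
    then have \<epsilon>: "0 < \<epsilon>" "\<epsilon> \<le> 1" "K * \<epsilon> < 1" using K by (auto simp: field_simps)
    let ?F = "F_poly n k r m (X_eps n k \<epsilon>)" and ?s = "sigma k (X_eps n k \<epsilon>) / C"
    note F = F_poly_X_eps[OF k(1,3) assms(3) r assms(5) q_less \<epsilon>(1,2)]
    have s: "\<epsilon> / C \<le> ?s" using sigma_X_eps_ge[OF \<epsilon>(1) k(1,3)] C by (simp add: divide_right_mono)
    \<comment> \<open>The roots are compared through their powers of exponent m k, which are
      \<open>?F ^ k\<close> and \<open>?s ^ m\<close>.\<close>
    have "?F ^ k \<le> (\<epsilon> ^ r * (1 / (1 - q)) ^ m) ^ k"
      using F by (intro power_mono)
    also have "\<dots> = \<epsilon> ^ (r * k) * (1 / (1 - q)) ^ (m * k)"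
      by (simp add: power_mult_distrib power_divide flip: power_mult)
    also have "\<dots> \<le> \<epsilon> ^ Suc m * (1 / (1 - q)) ^ (m * k)"
      using rk \<epsilon> q1 by (intro mult_right_mono power_decreasing) auto
    also have "\<dots> = (\<epsilon> / C) ^ m * (K * \<epsilon>)"
      using C by (simp add: K_def power_divide)
    also have "\<dots> < (\<epsilon> / C) ^ m * 1"
      using \<epsilon> C by (intro mult_strict_left_mono) auto
    also have "\<dots> \<le> ?s ^ m"
      using s \<epsilon> C by (simp only: mult_1_right) (intro power_mono, auto)
    finally have less: "?F ^ k < ?s ^ m" .
    have s0: "0 \<le> ?s" using s \<epsilon> C by (meson divide_nonneg_pos less_imp_le order_trans)
    have "root m ?F ^ (m * k) = ?F ^ k"
      using F(1) assms(4) by (simp add: power_mult)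
    moreover have "root k ?s ^ (m * k) = ?s ^ m"
      using s0 k(1) by (subst mult.commute) (simp add: power_mult)
    ultimately have "root m ?F ^ (m * k) < root k ?s ^ (m * k)" using less by simp
    then have "root m ?F < root k ?s"
      by (rule power_less_imp_less_base) (simp only: s0 real_root_ge_zero)
    moreover have "F_poly n k r m (1\<^sub>m n) = 1"
      using F_poly_one[OF k(1,3), of r m] r by simp
    moreover have "diagonal_mat (X_eps n k \<epsilon>)"
      by (auto simp: diagonal_mat_def X_eps_def mat_diag_def)
    ultimately show ?case
      using pos_def_X_eps[OF \<epsilon>(1)] assms(4) by (simp add: C_def)
  qed
qed

end
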